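(* There exists $\varepsilon_0>0$ such that the following holds for every constant $\varepsilon$ with $|\varepsilon|<\varepsilon_0$. Let $$a(x)=\begin{pmatrix}1+\frac{\varepsilon x_2^2}{|x|^2}&-\frac{\varepsilon x_1x_2}{|x|^2}\\[2pt]-\frac{\varepsilon x_1x_2}{|x|^2}&1+\frac{\varepsilon x_1^2}{|x|^2}\end{pmatrix},\qquad x=(x_1,x_2)\in\mathbb{R}^2\setminus\{0\},$$ and let $v\ge0$ be a solution of $\sum_{i,j}a_{ij}v_{ij}=\chi_{\{v>0\}}$ in $\mathbb{R}^2$ which is homogeneous of degree $2$. Assume that $0\in\partial\{v>0\}$ and that $\partial\{v>0\}$ is differentiable at the origin. Then $\varepsilon=0$ (and thus $a_{ij}=\delta_{ij}$).
   Context: $v_{ij}=\partial^2_{ij}v$ and $\chi_{\{v>0\}}$ is the characteristic function of $\{v>0\}$. A solution is a strong solution: $v\in W^{2,2}_{loc}(\mathbb{R}^2)$ (here $n=2$) and the equation holds almost everywhere. Homogeneous of degree $2$ means $v(tx)=t^2v(x)$ for all $t>0$, $x\in\mathbb{R}^2$. "$\partial\{v>0\}$ is differentiable at the origin" means that, near the origin and up to a rotation of coordinates, $\{v>0\}$ coincides with $\{x_2<\varphi(x_1)\}$ for some function $\varphi$ with $\varphi(0)=0$ that is differentiable at $0$ with $\varphi'(0)=0$. *)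

theory Defs
  imports "HOL-Analysis.Analysis"
begin

definition partial_deriv :: "'n::finite \<Rightarrow> (real^'n \<Rightarrow> real) \<Rightarrow> real^'n \<Rightarrow> real" where
  "partial_deriv i f x = frechet_derivative f (at x) (axis i 1)"

primrec Ck :: "nat \<Rightarrow> (real^'n::finite \<Rightarrow> real) \<Rightarrow> bool" where
  "Ck 0 f \<longleftrightarrow> continuous_on UNIV f"
| "Ck (Suc k) f \<longleftrightarrow> (\<forall>x. f differentiable at x) \<and> (\<forall>i. Ck k (partial_deriv i f))"

definition test_function :: "(real^'n::finite \<Rightarrow> real) \<Rightarrow> bool" where
  "test_function \<phi> \<longleftrightarrow> (\<forall>k. Ck k \<phi>) \<and> compact (closure {x. \<phi> x \<noteq> 0})"

definition L2_loc :: "(real^'n::finite \<Rightarrow> real) \<Rightarrow> bool" where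
  "L2_loc u \<longleftrightarrow> u \<in> borel_measurable lebesgue \<and>
     (\<forall>K. compact K \<longrightarrow> set_integrable lebesgue K (\<lambda>x. (u x)\<^sup>2))"

text \<open>Only meaningful for locally integrable \<open>u\<close> and \<open>g\<close>; below it is used on \<open>L2_loc\<close> functions.\<close>

definition has_weak_partial ::
    "'n::finite \<Rightarrow> (real^'n \<Rightarrow> real) \<Rightarrow> (real^'n \<Rightarrow> real) \<Rightarrow> bool" where
  "has_weak_partial i u g \<longleftrightarrow>
     (\<forall>\<phi>. test_function \<phi> \<longrightarrow>
        (\<integral>x. u x * partial_deriv i \<phi> x \<partial>lebesgue) = - (\<integral>x. g x * \<phi> x \<partial>lebesgue))"

text \<open>\<open>v\<close> belongs to $W^{2,2}_{loc}$, with weak gradient \<open>D\<close> and weak Hessian \<open>H\<close>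
  (both unique up to null sets).\<close>

definition W22_loc_with ::
    "(real^'n::finite \<Rightarrow> real) \<Rightarrow> ('n \<Rightarrow> real^'n \<Rightarrow> real) \<Rightarrow> ('n \<Rightarrow> 'n \<Rightarrow> real^'n \<Rightarrow> real) \<Rightarrow> bool" where
  "W22_loc_with v D H \<longleftrightarrow>
     L2_loc v \<and>
     (\<forall>i. L2_loc (D i) \<and> has_weak_partial i v (D i)) \<and>
     (\<forall>i j. L2_loc (H i j) \<and> has_weak_partial j (D i) (H i j))"

text \<open>Strong solutions of $\sum_{i,j} a_{ij} v_{ij} = \chi_{\{v>0\}}$ on the whole space.
  The equation is required almost everywhere, so the value of \<open>a\<close> at a single point is irrelevant.\<close>

definition strong_solution :: "(real^'n::finite \<Rightarrow> real^'n^'n) \<Rightarrow> (real^'n \<Rightarrow> real) \<Rightarrow> bool" where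
  "strong_solution a v \<longleftrightarrow>
     (\<exists>D H. W22_loc_with v D H \<and>
        (AE x in lebesgue. (\<Sum>i\<in>UNIV. \<Sum>j\<in>UNIV. a x $ i $ j * H i j x) = indicator {y. v y > 0} x))"

definition homogeneous_deg2 :: "(real^'n::finite \<Rightarrow> real) \<Rightarrow> bool" where
  "homogeneous_deg2 v \<longleftrightarrow> (\<forall>t>0. \<forall>x. v (t *\<^sub>R x) = t\<^sup>2 * v x)"

text \<open>Near the origin and after a rotation, \<open>U\<close> is the strict subgraph of a function that vanishes
  at \<open>0\<close> and is differentiable there with zero derivative.\<close>

definition boundary_differentiable_at_origin :: "(real^2) set \<Rightarrow> bool" where
  "boundary_differentiable_at_origin U \<longleftrightarrow>
     (\<exists>Q :: real^2^2. \<exists>\<phi> :: real \<Rightarrow> real. \<exists>r>0.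
        rotation_matrix Q \<and> \<phi> 0 = 0 \<and> (\<phi> has_real_derivative 0) (at 0) \<and>
        (\<forall>x\<in>ball 0 r. Q *v x \<in> U \<longleftrightarrow> x $ 2 < \<phi> (x $ 1)))"

text \<open>At \<open>x = 0\<close> division by zero makes this the identity matrix; that value is never used.\<close>

definition coeff_matrix :: "real \<Rightarrow> real^2 \<Rightarrow> real^2^2" where
  "coeff_matrix \<epsilon> x = vector
     [vector [1 + \<epsilon> * (x $ 2)\<^sup>2 / (norm x)\<^sup>2, - (\<epsilon> * x $ 1 * x $ 2 / (norm x)\<^sup>2)],
      vector [- (\<epsilon> * x $ 1 * x $ 2 / (norm x)\<^sup>2), 1 + \<epsilon> * (x $ 1)\<^sup>2 / (norm x)\<^sup>2]]"

end

theory Submission imports Defs begin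

text \<open>Since \<open>a = (1 + \<epsilon>) I - \<epsilon> x \<otimes> x / |x|\<^sup>2\<close> and \<open>v = r\<^sup>2 g(\<theta>)\<close>, the equation reads
  \<open>(1 + \<epsilon>) g'' + (4 + 2\<epsilon>) g = \<chi>\<close>. As \<open>{v > 0}\<close> is a cone with differentiable boundary, \<open>\<chi>\<close> is the
  indicator of a half circle, \<open>|\<theta>| < \<pi>/2\<close> say. Testing with \<open>cos n\<theta>\<close> for \<open>n = 0, 1, 2\<close> gives
  \<open>(4 + 2\<epsilon>) \<integral> g = \<pi>\<close>, \<open>(3 + \<epsilon>) \<integral> g cos \<theta> = 2\<close> and \<open>- 2\<epsilon> \<integral> g cos 2\<theta> = 0\<close>. If \<open>\<epsilon> \<noteq> 0\<close> then
  \<open>\<integral> g cos 2\<theta> = 0\<close>, and \<open>0 \<le> \<integral> g (cos \<theta> - 1/2)\<^sup>2 = 3/4 \<integral> g - \<integral> g cos \<theta>\<close> contradicts the other two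
  identities for small \<open>\<epsilon>\<close>. Everything is done in Cartesian coordinates, with the test functions
  multiplied by a radial bump. Instead of \<open>2/\<pi>\<close>, only the lower bound \<open>0.576\<close> for the mean of
  \<open>cos \<theta>\<close> over the half circle is used.\<close>

subsection \<open>Smooth functions and a flat function\<close>

lemma partial_deriv_eq:
  "(f has_derivative f') (at x) \<Longrightarrow> partial_deriv i f x = f' (axis i 1)"
  unfolding partial_deriv_def using frechet_derivative_at by metis

lemma has_derivative_partial_deriv:
  fixes f :: "real^'n::finite \<Rightarrow> real"
  assumes "f differentiable at x"
  shows "(f has_derivative (\<lambda>h. \<Sum>i\<in>UNIV. h $ i * partial_deriv i f x)) (at x)"
proof -
  have D: "(f has_derivative frechet_derivative f (at x)) (at x)"
    using assms frechet_derivative_works by blast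
  interpret linear "frechet_derivative f (at x)"
    using D has_derivative_linear by blast
  have "frechet_derivative f (at x) h = (\<Sum>i\<in>UNIV. h $ i * partial_deriv i f x)" for h
  proof -
    have "frechet_derivative f (at x) h = frechet_derivative f (at x) (\<Sum>i\<in>UNIV. h $ i *\<^sub>R axis i 1)"
      by (simp add: basis_expansion flip: scalar_mult_eq_scaleR)
    then show ?thesis
      by (simp add: sum scale partial_deriv_def)
  qed
  then have "frechet_derivative f (at x) = (\<lambda>h. \<Sum>i\<in>UNIV. h $ i * partial_deriv i f x)" by blast
  with D show ?thesis by simp
qed

lemma partial_deriv_const: "partial_deriv i (\<lambda>x. c) x = 0"
  by (subst partial_deriv_eq[OF has_derivative_const]) simp

lemma partial_deriv_add:
  assumes "f differentiable at x" "g differentiable at x"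
  shows "partial_deriv i (\<lambda>x. f x + g x) x = partial_deriv i f x + partial_deriv i g x"
  using partial_deriv_eq[OF has_derivative_add] assms
  unfolding partial_deriv_def frechet_derivative_works by blast

lemma partial_deriv_mult:
  assumes "f differentiable at x" "g differentiable at x"
  shows "partial_deriv i (\<lambda>x. f x * g x) x = f x * partial_deriv i g x + partial_deriv i f x * g x"
  using partial_deriv_eq[OF has_derivative_mult] assms
  unfolding partial_deriv_def frechet_derivative_works by blast

lemma partial_deriv_coord:
  "partial_deriv i (\<lambda>x::real^'n::finite. x $ j) x = (if i = j then 1 else 0)"
proof -
  have "((\<lambda>x::real^'n. x $ j) has_derivative (\<lambda>h. h $ j)) (at x)"
    by (rule bounded_linear_imp_has_derivative) (rule bounded_linear_vec_nth)
  from partial_deriv_eq[OF this] show ?thesis by (simp add: axis_def)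
qed

lemma differentiable_coord: "(\<lambda>x::real^'n::finite. x $ j) differentiable at x"
  by (rule bounded_linear_imp_differentiable) (rule bounded_linear_vec_nth)

text \<open>Chain rule. The affine argument covers both cutoffs used in \<open>annular\<close>, the
  inner one in |x|^2 - 1 and the outer one in 4 - |x|^2.\<close>

lemma partial_deriv_radial:
  fixes x :: "real^'n::finite"
  assumes "(f has_real_derivative d) (at (\<alpha> + \<beta> * (norm x)\<^sup>2))"
  shows "(\<lambda>x. f (\<alpha> + \<beta> * (norm x)\<^sup>2)) differentiable at x"
    and "partial_deriv i (\<lambda>x. f (\<alpha> + \<beta> * (norm x)\<^sup>2)) x = 2 * \<beta> * x $ i * d"
proof -
  \<comment> \<open>The inner product form is differentiable also at the origin, where the norm is
    not.\<close>
  have "((\<lambda>x. \<alpha> + \<beta> * (x \<bullet> x)) has_derivative (\<lambda>h. 2 * \<beta> * (x \<bullet> h))) (at x)"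
    by (auto intro!: derivative_eq_intros simp: inner_commute algebra_simps)
  then have "((\<lambda>x. f (\<alpha> + \<beta> * (x \<bullet> x))) has_derivative (\<lambda>h. (2 * \<beta> * (x \<bullet> h)) * d)) (at x)"
    using assms has_derivative_compose[of "\<lambda>x. \<alpha> + \<beta> * (x \<bullet> x)" _ x UNIV f "(*) d"]
    by (simp add: has_field_derivative_def power2_norm_eq_inner mult.commute)
  then have D: "((\<lambda>x. f (\<alpha> + \<beta> * (norm x)\<^sup>2)) has_derivative (\<lambda>h. (2 * \<beta> * (x \<bullet> h)) * d)) (at x)"
    by (simp add: power2_norm_eq_inner)
  then show "(\<lambda>x. f (\<alpha> + \<beta> * (norm x)\<^sup>2)) differentiable at x"
    by (rule differentiableI)
  show "partial_deriv i (\<lambda>x. f (\<alpha> + \<beta> * (norm x)\<^sup>2)) x = 2 * \<beta> * x $ i * d"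
    by (subst partial_deriv_eq[OF D]) (simp add: inner_axis)
qed

lemma Ck_imp_continuous: "Ck k f \<Longrightarrow> continuous_on UNIV f"
  by (cases k)
    (auto intro!: continuous_at_imp_continuous_on dest: differentiable_imp_continuous_within)

lemma Ck_Suc_imp: "Ck (Suc k) f \<Longrightarrow> Ck k f"
proof (induction k arbitrary: f)
  case 0
  then show ?case by (metis Ck.simps(1) Ck_imp_continuous)
next
  case (Suc k)
  then show ?case by (metis Ck.simps(2))
qed

lemma Ck_const: "Ck k (\<lambda>x::real^'n::finite. c)"
proof (induction k arbitrary: c)
  case (Suc k)
  have "partial_deriv i (\<lambda>x::real^'n. c) = (\<lambda>x. 0)" for i :: 'n
    by (rule ext) (rule partial_deriv_const)
  with Suc show ?case by simp
qed simp

lemma Ck_add: "Ck k f \<Longrightarrow> Ck k g \<Longrightarrow> Ck k (\<lambda>x. f x + g x)"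
proof (induction k arbitrary: f g)
  case (Suc k)
  have "partial_deriv i (\<lambda>x. f x + g x) = (\<lambda>x. partial_deriv i f x + partial_deriv i g x)" for i
    using Suc.prems by (intro ext partial_deriv_add) auto
  with Suc show ?case by simp
qed (auto intro: continuous_intros)

lemma Ck_mult: "Ck k f \<Longrightarrow> Ck k g \<Longrightarrow> Ck k (\<lambda>x. f x * g x)"
proof (induction k arbitrary: f g)
  case (Suc k)
  have "partial_deriv i (\<lambda>x. f x * g x) = (\<lambda>x. f x * partial_deriv i g x + partial_deriv i f x * g x)" for i
    using Suc.prems by (intro ext partial_deriv_mult) auto
  moreover have "Ck k f" "Ck k g" using Suc.prems Ck_Suc_imp by blast+
  ultimately show ?case using Suc by (simp add: Ck_add)
qed (auto intro: continuous_intros)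

section \<open>The class of smooth functions and its closure properties\<close>

definition smooth :: "(real^'n::finite \<Rightarrow> real) \<Rightarrow> bool" where
  "smooth f \<longleftrightarrow> (\<forall>k. Ck k f)"

named_theorems smooth_intros

lemma smooth_const [smooth_intros]: "smooth (\<lambda>x. c)"
  by (simp add: smooth_def Ck_const)

lemma smooth_add [smooth_intros]: "smooth f \<Longrightarrow> smooth g \<Longrightarrow> smooth (\<lambda>x. f x + g x)"
  by (simp add: smooth_def Ck_add)

lemma smooth_mult [smooth_intros]: "smooth f \<Longrightarrow> smooth g \<Longrightarrow> smooth (\<lambda>x. f x * g x)"
  by (simp add: smooth_def Ck_mult)

lemma smooth_diff [smooth_intros]: "smooth f \<Longrightarrow> smooth g \<Longrightarrow> smooth (\<lambda>x. f x - g x)"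
  using smooth_add[of f "\<lambda>x. - 1 * g x"] smooth_mult[OF smooth_const[of "- 1"], of g] by simp

lemma smooth_minus [smooth_intros]: "smooth f \<Longrightarrow> smooth (\<lambda>x. - f x)"
  using smooth_mult[OF smooth_const[of "- 1"], of f] by simp

lemma smooth_power2 [smooth_intros]: "smooth f \<Longrightarrow> smooth (\<lambda>x. (f x)\<^sup>2)"
  by (simp add: power2_eq_square smooth_mult)

lemma smooth_partial_deriv [smooth_intros]: "smooth f \<Longrightarrow> smooth (partial_deriv i f)"
  unfolding smooth_def by (metis Ck.simps(2))

lemma smooth_differentiable: "smooth f \<Longrightarrow> f differentiable at x"
  unfolding smooth_def by (metis Ck.simps(2))

lemma smooth_continuous: "smooth f \<Longrightarrow> continuous_on UNIV f"
  unfolding smooth_def using Ck_imp_continuous by blast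

lemma smoothI:
  assumes "\<And>x. f differentiable at x" "\<And>i. smooth (partial_deriv i f)"
  shows "smooth f"
proof -
  have "Ck k f" for k
    using assms by (cases k)
      (auto simp: smooth_def intro!: continuous_at_imp_continuous_on dest: differentiable_imp_continuous_within)
  then show ?thesis by (simp add: smooth_def)
qed

lemma smooth_coord [smooth_intros]: "smooth (\<lambda>x. x $ j)"
proof (rule smoothI)
  show "smooth (partial_deriv i (\<lambda>x. x $ j))" for i
    by (simp add: partial_deriv_coord[abs_def] smooth_const)
qed (rule differentiable_coord)

text \<open>The two exponents make the family closed under differentiation.\<close>

definition flat :: "nat \<Rightarrow> nat \<Rightarrow> real \<Rightarrow> real" where
  "flat N M t = (if t > 0 then exp (- (1/t)) / (t^N * sqrt (1 + t)^M) else 0)"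

lemma flat_nonneg: "flat N M t \<ge> 0"
  by (simp add: flat_def)

lemma power_div_fact_le_exp: "(x::real) ^ n / fact n \<le> exp x" if "x \<ge> 0"
proof -
  have "(\<Sum>k\<in>{n}. x ^ k /\<^sub>R fact k) \<le> (\<Sum>k. x ^ k /\<^sub>R fact k)"
    using that by (intro sum_le_suminf summable_exp_generic) auto
  then show ?thesis
    by (simp add: exp_def divide_inverse mult.commute)
qed

text \<open>One term of the exponential series gives exp (1/t) \<ge> (1/t)^(N+k) / (N+k)!, and the
  factor \<open>sqrt (1 + t) ^ M\<close> in the denominator is at least 1. Since k is free,
  \<open>flat\<close> vanishes to every order at 0.\<close>

lemma flat_le:
  assumes "t > 0" shows "flat N M t \<le> fact (N + k) * t ^ k"
proof -
  have "(1/t)^(N + k) / fact (N + k) \<le> exp (1/t)"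
    using assms by (intro power_div_fact_le_exp) simp
  then have "exp (- (1/t)) \<le> fact (N + k) * t ^ (N + k)"
    using assms by (simp add: exp_minus field_simps)
  also have "\<dots> = (fact (N + k) * t ^ k) * (t ^ N * 1)"
    by (simp add: power_add)
  also have "\<dots> \<le> (fact (N + k) * t ^ k) * (t ^ N * sqrt (1 + t) ^ M)"
    using assms by (intro mult_left_mono one_le_power) auto
  finally show ?thesis
    using assms by (simp add: flat_def divide_le_eq)
qed

text \<open>Differentiating exp (-1/t), t^-N and (1 + t)^(-M/2) raises (N, M) to (N+2, M), (N+1, M)
  and (N, M+2), so the derivative stays in the span of the family. The same formula holds for t
  \<le> 0, where every member is 0.\<close>

lemma flat_has_derivative:
  "(flat N M has_real_derivative
     (flat (N+2) M t - real N * flat (Suc N) M t - real M / 2 * flat N (M+2) t)) (at t)"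
proof -
  consider "t > 0" | "t < 0" | "t = 0" by linarith
  then show ?thesis
  proof cases
    case 1
    have iw: "((\<lambda>t. inverse (sqrt (1 + t)) ^ M) has_real_derivative
        (- (real M / 2 * inverse (sqrt (1 + t)) ^ (M + 2)))) (at t)"
    proof -
      have "((\<lambda>t. inverse (sqrt (1 + t))) has_real_derivative
          (- (inverse (sqrt (1 + t)) ^ 3 / 2))) (at t)"
        using 1 by (auto intro!: derivative_eq_intros simp: field_simps eval_nat_numeral)
      from DERIV_power[OF this, of M] show ?thesis
        by (cases M) (auto simp: power_add eval_nat_numeral mult_ac)
    qed
    have it: "((\<lambda>t. inverse t ^ N) has_real_derivative (- (real N * inverse t ^ (Suc N)))) (at t)"
    proof -
      have "(inverse has_real_derivative (- (inverse t ^ 2))) (at t)"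
        using 1 by (auto intro!: derivative_eq_intros simp: power2_eq_square)
      from DERIV_power[OF this, of N] show ?thesis
        by (cases N) (auto simp: power_add eval_nat_numeral mult_ac)
    qed
    have ie: "((\<lambda>t. exp (- inverse t)) has_real_derivative (exp (- inverse t) * inverse t ^ 2)) (at t)"
      using 1 by (auto intro!: derivative_eq_intros simp: power2_eq_square)
    have eq: "flat N M t = exp (- inverse t) * inverse t ^ N * inverse (sqrt (1 + t)) ^ M"
      if "t > 0" for N M and t :: real
      using that by (simp add: flat_def divide_inverse power_inverse mult.assoc)
    have "((\<lambda>t. exp (- inverse t) * inverse t ^ N * inverse (sqrt (1 + t)) ^ M) has_real_derivative
       (flat (N+2) M t - real N * flat (Suc N) M t - real M / 2 * flat N (M+2) t)) (at t)"
      by (rule DERIV_cong[OF DERIV_mult[OF DERIV_mult[OF ie it] iw]])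
        (simp only: eq[OF 1] power_add power_Suc ring_distribs, simp add: mult_ac)
    then show ?thesis
      by (rule has_field_derivative_transform_within[where d = t])
        (use 1 eq in \<open>auto simp: dist_real_def\<close>)
  next
    case 2
    have "((\<lambda>t. 0) has_real_derivative 0) (at t)" by simp
    then have "(flat N M has_real_derivative 0) (at t)"
      by (rule has_field_derivative_transform_within[where d = "- t"])
        (use 2 in \<open>auto simp: flat_def dist_real_def\<close>)
    with 2 show ?thesis by (simp add: flat_def)
  next
    case 3
    \<comment> \<open>Vanishing to order 2 bounds the difference quotient at 0 by a multiple of
      |h|.\<close>
    have b: "\<bar>flat N M h\<bar> \<le> fact (N + 2) * h\<^sup>2" for h
      using flat_le[of h N M 2] by (cases "h > 0") (auto simp: abs_of_nonneg flat_nonneg, simp add: flat_def)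
    have "((\<lambda>h. flat N M h / h) \<longlongrightarrow> 0) (at 0)"
    proof (rule Lim_null_comparison)
      have "norm (flat N M h / h) \<le> fact (N + 2) * \<bar>h\<bar>" if "h \<noteq> 0" for h
      proof -
        have "\<bar>flat N M h\<bar> \<le> (fact (N + 2) * \<bar>h\<bar>) * \<bar>h\<bar>"
          using b[of h] by (simp only: mult.assoc power2_eq_square abs_mult_self_eq)
        then show ?thesis using that by (simp add: divide_le_eq)
      qed
      then show "\<forall>\<^sub>F h in at 0. norm (flat N M h / h) \<le> fact (N + 2) * \<bar>h\<bar>"
        unfolding eventually_at_filter by (intro always_eventually) blast
      show "((\<lambda>h. fact (N + 2) * \<bar>h\<bar>) \<longlongrightarrow> 0) (at (0::real))"
        by (auto intro!: tendsto_eq_intros)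
    qed
    then show ?thesis
      using 3 by (simp add: DERIV_def flat_def)
  qed
qed

text \<open>Induction on the order of differentiability for all N and M at once: each partial
  derivative is a coordinate times a linear combination of three members of the family.\<close>

lemma smooth_flat [smooth_intros]:
  "smooth (\<lambda>x::real^'n::finite. flat N M (\<alpha> + \<beta> * (norm x)\<^sup>2))"
proof -
  have "Ck k (\<lambda>x::real^'n. flat N M (\<alpha> + \<beta> * (norm x)\<^sup>2))" for k
  proof (induction k arbitrary: N M)
    case 0
    show ?case
      using differentiable_imp_continuous_within[OF partial_deriv_radial(1)[OF flat_has_derivative]]
      by (auto intro!: continuous_at_imp_continuous_on)
  next
    case (Suc k)
    have pd: "partial_deriv i (\<lambda>x::real^'n. flat N M (\<alpha> + \<beta> * (norm x)\<^sup>2)) =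
        (\<lambda>x. (2 * \<beta>) * x $ i *
          (flat (N+2) M (\<alpha> + \<beta> * (norm x)\<^sup>2) + (- real N) * flat (Suc N) M (\<alpha> + \<beta> * (norm x)\<^sup>2)
           + (- (real M / 2)) * flat N (M+2) (\<alpha> + \<beta> * (norm x)\<^sup>2)))" for i
      by (rule ext, subst partial_deriv_radial(2)[OF flat_has_derivative]) simp
    have coord: "Ck k (\<lambda>x::real^'n. x $ i)" for i
      using smooth_coord smooth_def by blast
    show ?case
      unfolding Ck.simps pd
      by (intro conjI allI partial_deriv_radial(1)[OF flat_has_derivative]
          Ck_mult Ck_add Ck_const coord Suc.IH)
  qed
  then show ?thesis by (simp add: smooth_def)
qed

subsection \<open>Test functions, weak derivatives and homogeneity\<close>

lemma test_function_iff: "test_function \<phi> \<longleftrightarrow> smooth \<phi> \<and> compact (closure {x. \<phi> x \<noteq> 0})"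
  by (simp add: test_function_def smooth_def)

lemma test_function_smooth: "test_function \<phi> \<Longrightarrow> smooth \<phi>"
  by (simp add: test_function_iff)

lemma test_functionI:
  assumes "smooth \<phi>" "\<And>x. norm x > R \<Longrightarrow> \<phi> x = 0"
  shows "test_function \<phi>"
proof -
  have "{x. \<phi> x \<noteq> 0} \<subseteq> cball 0 R"
    using assms(2) by (force simp: not_less[symmetric])
  then have "bounded {x. \<phi> x \<noteq> 0}" using bounded_cball bounded_subset by blast
  with assms(1) show ?thesis
    by (simp add: test_function_iff compact_closure)
qed

lemma test_function_support:
  assumes "test_function \<phi>"
  obtains R where "R > 0" "\<And>x. norm x > R \<Longrightarrow> \<phi> x = 0"
proof -
  have "bounded {x. \<phi> x \<noteq> 0}"
    using assms by (simp add: test_function_iff compact_closure)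
  then obtain R where "R > 0" "\<forall>x\<in>{x. \<phi> x \<noteq> 0}. norm x \<le> R"
    using bounded_pos by blast
  then show ?thesis using that[of R] by force
qed

lemma test_function_mult: "smooth p \<Longrightarrow> test_function \<phi> \<Longrightarrow> test_function (\<lambda>x. p x * \<phi> x)"
  by (rule test_function_support, assumption)
    (rule test_functionI, auto intro: smooth_intros test_function_smooth)

lemma test_function_add:
  assumes "test_function \<phi>" "test_function \<psi>"
  shows "test_function (\<lambda>x. \<phi> x + \<psi> x)"
proof -
  obtain R where R: "\<And>x. norm x > R \<Longrightarrow> \<phi> x = 0"
    using test_function_support[OF assms(1)] by blast
  obtain S where S: "\<And>x. norm x > S \<Longrightarrow> \<psi> x = 0"
    using test_function_support[OF assms(2)] by blast
  show ?thesis
    by (rule test_functionI[where R = "max R S"])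
      (use assms R S in \<open>auto intro: smooth_intros test_function_smooth\<close>)
qed

lemma test_function_diff:
  assumes "test_function \<phi>" "test_function \<psi>"
  shows "test_function (\<lambda>x. \<phi> x - \<psi> x)"
  using test_function_add[OF assms(1) test_function_mult[OF smooth_const[of "- 1"] assms(2)]] by simp

lemma test_function_sum:
  "(\<And>i. i \<in> I \<Longrightarrow> test_function (f i)) \<Longrightarrow> test_function (\<lambda>x. \<Sum>i\<in>I. f i x)"
proof (induction I rule: infinite_finite_induct)
  case (insert i I)
  then show ?case by (simp add: test_function_add)
qed (auto intro!: test_functionI[where R = 0] smooth_const)

lemma test_function_partial_deriv:
  assumes "test_function \<phi>"
  shows "test_function (partial_deriv i \<phi>)"
proof -
  obtain R where R: "R > 0" "\<And>x. norm x > R \<Longrightarrow> \<phi> x = 0"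
    using test_function_support[OF assms] by blast
  have "partial_deriv i \<phi> x = 0" if "norm x > R" for x
  proof -
    have op: "open {x::real^'a. norm x > R}"
      by (intro open_Collect_less continuous_intros)
    have "(\<phi> has_derivative (\<lambda>h. 0)) (at x)"
      by (rule has_derivative_transform_within_open[OF has_derivative_const op, of x 0])
        (use that R in auto)
    from partial_deriv_eq[OF this] show ?thesis .
  qed
  then show ?thesis
    by (rule test_functionI[rotated]) (use assms in \<open>auto intro: smooth_intros test_function_smooth\<close>)
qed

lemma test_function_bounded:
  assumes "test_function \<phi>"
  obtains C where "\<And>x. \<bar>\<phi> x\<bar> \<le> C"
proof -
  obtain R where R: "R > 0" "\<And>x. norm x > R \<Longrightarrow> \<phi> x = 0"
    using test_function_support[OF assms] by blast
  have "compact (\<phi> ` cball 0 R)"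
    by (rule compact_continuous_image)
      (use assms smooth_continuous[OF test_function_smooth] continuous_on_subset[OF _ subset_UNIV] in auto)
  then obtain C where C: "\<forall>y\<in>\<phi> ` cball 0 R. norm y \<le> C"
    using compact_imp_bounded bounded_iff by metis
  have "\<bar>\<phi> x\<bar> \<le> max C 0" for x
    using C R(2)[of x] by (cases "norm x > R") (auto simp: not_less le_max_iff_disj)
  then show ?thesis by (rule that)
qed

section \<open>Integrability against test functions and weak second derivatives\<close>

lemma smooth_measurable: "smooth \<phi> \<Longrightarrow> \<phi> \<in> borel_measurable lebesgue"
  by (rule measurable_completion) (simp add: borel_measurable_continuous_onI smooth_continuous)

text \<open>On a bounded set L^2 lies in L^1: |u| \<le> u^2 + 1, and the constant 1 is integrable on
  the ball.\<close>

lemma L2_loc_integrable_cball: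
  assumes "L2_loc u"
  shows "integrable lebesgue (\<lambda>x. indicator (cball 0 R) x * \<bar>u x\<bar>)"
proof -
  have [measurable]: "u \<in> borel_measurable lebesgue" using assms by (simp add: L2_loc_def)
  have [measurable]: "cball (0::real^'a) R \<in> sets lebesgue" by simp
  have "set_integrable lebesgue (cball 0 R) (\<lambda>x. (u x)\<^sup>2)"
    using assms compact_cball by (auto simp: L2_loc_def)
  moreover have "set_integrable lebesgue (cball 0 R) (\<lambda>x::real^'a. 1::real)"
    using lmeasurable_compact[OF compact_cball, of "0::real^'a" R]
    by (simp add: set_integrable_def fmeasurable_def)
  ultimately have "set_integrable lebesgue (cball 0 R) (\<lambda>x. (u x)\<^sup>2 + 1)"
    by (rule set_integral_add)
  then have "integrable lebesgue (\<lambda>x. indicator (cball 0 R) x * ((u x)\<^sup>2 + 1))"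
    by (simp add: set_integrable_def)
  then show ?thesis
  proof (rule Bochner_Integration.integrable_bound)
    have "\<bar>u x\<bar> \<le> (u x)\<^sup>2 + 1" for x
      using sum_squares_bound[of "\<bar>u x\<bar>" 1] by (auto simp: power2_eq_square)
    then show "AE x in lebesgue. norm (indicat_real (cball 0 R) x * \<bar>u x\<bar>)
        \<le> norm (indicat_real (cball 0 R) x * ((u x)\<^sup>2 + 1))"
      by (auto intro!: AE_I2 simp: indicator_def)
  qed measurable
qed

lemma integrable_L2_loc_test:
  assumes "L2_loc u" "test_function \<phi>"
  shows "integrable lebesgue (\<lambda>x. u x * \<phi> x)"
proof -
  obtain R where R: "\<And>x. norm x > R \<Longrightarrow> \<phi> x = 0"
    using test_function_support[OF assms(2)] by blast
  obtain C where C: "\<And>x. \<bar>\<phi> x\<bar> \<le> C"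
    using test_function_bounded[OF assms(2)] by blast
  have [measurable]: "u \<in> borel_measurable lebesgue" "\<phi> \<in> borel_measurable lebesgue"
    using assms smooth_measurable test_function_smooth by (auto simp: L2_loc_def)
  have "integrable lebesgue (\<lambda>x. C * (indicator (cball 0 R) x * \<bar>u x\<bar>))"
    using L2_loc_integrable_cball[OF assms(1)] by simp
  then show ?thesis
  proof (rule Bochner_Integration.integrable_bound)
    have "norm (u x * \<phi> x) \<le> norm (C * (indicator (cball 0 R) x * \<bar>u x\<bar>))" for x
    proof (cases "norm x > R")
      case False
      have "\<bar>u x\<bar> * \<bar>\<phi> x\<bar> \<le> \<bar>u x\<bar> * \<bar>C\<bar>"
        using C[of x] by (intro mult_left_mono) auto
      with False show ?thesis by (simp add: abs_mult mult.commute)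
    qed (use R in simp)
    then show "AE x in lebesgue. norm (u x * \<phi> x) \<le> norm (C * (indicator (cball 0 R) x * \<bar>u x\<bar>))"
      by simp
  qed measurable
qed

text \<open>Two integrations by parts, whose signs cancel. \<open>H i j\<close> is the j-th
  derivative of \<open>D i\<close>, so the j-th derivative falls on the test function first.\<close>

lemma weak_second_partial:
  assumes "W22_loc_with v D H" "test_function \<phi>"
  shows "(\<integral>x. H i j x * \<phi> x \<partial>lebesgue) = (\<integral>x. v x * partial_deriv i (partial_deriv j \<phi>) x \<partial>lebesgue)"
proof -
  have "(\<integral>x. D i x * partial_deriv j \<phi> x \<partial>lebesgue) = - (\<integral>x. H i j x * \<phi> x \<partial>lebesgue)"
    using assms by (auto simp: W22_loc_with_def has_weak_partial_def)
  moreover have "(\<integral>x. v x * partial_deriv i (partial_deriv j \<phi>) x \<partial>lebesgue)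
      = - (\<integral>x. D i x * partial_deriv j \<phi> x \<partial>lebesgue)"
    using assms test_function_partial_deriv[OF assms(2), of j]
    by (auto simp: W22_loc_with_def has_weak_partial_def)
  ultimately show ?thesis by simp
qed

section \<open>Dilations and the weak Euler identity\<close>

lemma integral_lebesgue_scaleR:
  fixes f :: "real^'n::finite \<Rightarrow> real"
  assumes "c > 0" and m: "f \<in> borel_measurable lebesgue"
  shows "(\<integral>x. f x \<partial>lebesgue) = c ^ CARD('n) * (\<integral>x. f (c *\<^sub>R x) \<partial>lebesgue)"
    and "integrable lebesgue f \<Longrightarrow> integrable lebesgue (\<lambda>x. f (c *\<^sub>R x))"
proof -
  let ?T = "\<lambda>x::real^'n. c *\<^sub>R x"
  \<comment> \<open>The dilation as a coordinatewise affine map, for which Lebesgue measure scales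
    by the product of the factors.\<close>
  have T: "(\<lambda>x::real^'n. 0 + (\<Sum>j\<in>Basis. (c * (x \<bullet> j)) *\<^sub>R j)) = ?T"
    unfolding scaleR_scaleR[symmetric] scaleR_sum_right[symmetric] euclidean_representation by simp
  have L: "lebesgue = density (distr lebesgue lebesgue ?T) (\<lambda>_. ennreal (c ^ CARD('n)))"
    using lebesgue_affine_euclidean[of "\<lambda>_. c" "0::real^'n"] assms(1)
    unfolding T prod_constant by (simp add: ennreal_power)
  have [measurable]: "?T \<in> lebesgue \<rightarrow>\<^sub>M lebesgue"
    using lebesgue_affine_measurable[of "\<lambda>_. c" "0::real^'n"] assms(1) unfolding T by simp
  note m[measurable]
  have "(\<integral>x. f x \<partial>lebesgue) =
      (\<integral>x. f x \<partial>density (distr lebesgue lebesgue ?T) (\<lambda>_. ennreal (c ^ CARD('n))))"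
    using L by simp
  also have "\<dots> = c ^ CARD('n) * (\<integral>x. f (c *\<^sub>R x) \<partial>lebesgue)"
    using assms(1) by (simp add: integral_density integral_distr)
  finally show "(\<integral>x. f x \<partial>lebesgue) = c ^ CARD('n) * (\<integral>x. f (c *\<^sub>R x) \<partial>lebesgue)" .
  assume "integrable lebesgue f"
  then have "integrable (density (distr lebesgue lebesgue ?T) (\<lambda>_. ennreal (c ^ CARD('n)))) f"
    using L by simp
  then show "integrable lebesgue (\<lambda>x. f (c *\<^sub>R x))"
    using assms(1) by (simp add: integrable_density integrable_distr_eq)
qed

text \<open>Euler's identity \<open>x \<cdot> \<nabla>v = 2v\<close> in weak form, from the invariance of \<open>\<integral> v(x) c\<^sup>n\<^sup>+\<^sup>2 w(c x) dx\<close>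
  under change of \<open>c\<close>.\<close>

lemma homogeneous_weak_Euler:
  fixes v :: "real^'n::finite \<Rightarrow> real"
  assumes v: "L2_loc v" "homogeneous_deg2 v" and w: "test_function w"
  shows "(\<integral>x. v x * (real (CARD('n) + 2) * w x + (\<Sum>i\<in>UNIV. x $ i * partial_deriv i w x)) \<partial>lebesgue) = 0"
proof -
  let ?N = "CARD('n) + 2"
  define z where "z = (\<lambda>x. real ?N * w x + (\<Sum>i\<in>UNIV. x $ i * partial_deriv i w x))"
  \<comment> \<open>Dilation factors in (1, 2] tending to 1; staying above 1 keeps every w (c x)
    supported in any centred ball that contains the support of w.\<close>
  define c where "c = (\<lambda>k::nat. 1 + 1 / real (Suc k))"
  have c: "c k > 1" "c k \<le> 2" for k by (auto simp: c_def)
  \<comment> \<open>Difference quotient at c = 1 of \<open>c ^ ?N * w (c *\<^sub>R x)\<close>, since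
    1 / (c k - 1) = k + 1; its limit is z.\<close>
  define q where "q = (\<lambda>k x. real (Suc k) * (c k ^ ?N * w (c k *\<^sub>R x) - w x))"
  have z: "test_function z"
    unfolding z_def by (intro test_function_add test_function_sum test_function_mult
        smooth_intros test_function_partial_deriv w)
  obtain R where R: "R > 0" "\<And>x. norm x > R \<Longrightarrow> w x = 0"
    using test_function_support[OF w] by blast
  obtain C where C: "\<And>x. \<bar>z x\<bar> \<le> C"
    using test_function_bounded[OF z] by blast
  have C0: "C \<ge> 0" using C[of 0] by linarith
  have vm[measurable]: "v \<in> borel_measurable lebesgue" using v by (simp add: L2_loc_def)
  have wm[measurable]: "w \<in> borel_measurable lebesgue"
    using smooth_measurable test_function_smooth w by blast
  have zm[measurable]: "z \<in> borel_measurable lebesgue"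
    using smooth_measurable test_function_smooth z by blast
  have deriv: "((\<lambda>c. c ^ ?N * w (c *\<^sub>R x)) has_real_derivative t ^ (?N - 1) * z (t *\<^sub>R x)) (at t)" for x t
  proof -
    have "((\<lambda>c. w (c *\<^sub>R x)) has_derivative
        (\<lambda>h. \<Sum>i\<in>UNIV. (h *\<^sub>R x) $ i * partial_deriv i w (t *\<^sub>R x))) (at t)"
      by (rule has_derivative_compose[of "\<lambda>c. c *\<^sub>R x"])
        (auto intro!: derivative_eq_intros has_derivative_partial_deriv
          smooth_differentiable test_function_smooth w)
    then have "((\<lambda>c. w (c *\<^sub>R x)) has_real_derivative
        (\<Sum>i\<in>UNIV. x $ i * partial_deriv i w (t *\<^sub>R x))) (at t)"
      by (rule has_derivative_imp_has_field_derivative) (simp add: sum_distrib_left sum_distrib_right mult_ac)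
    then have "((\<lambda>c. c ^ ?N * w (c *\<^sub>R x)) has_real_derivative
        real ?N * t ^ (?N - 1) * w (t *\<^sub>R x) +
        (\<Sum>i\<in>UNIV. x $ i * partial_deriv i w (t *\<^sub>R x)) * t ^ ?N) (at t)"
      unfolding One_nat_def by (intro DERIV_mult DERIV_pow)
    moreover have "t ^ ?N = t ^ (?N - 1) * t" by simp
    ultimately show ?thesis
      by (simp add: z_def algebra_simps sum_distrib_left sum_distrib_right)
  qed
  have int0: "integrable lebesgue (\<lambda>x. v x * w x)"
    by (rule integrable_L2_loc_test[OF v(1) w])
  \<comment> \<open>Homogeneity contributes c^2 to the Jacobian c^n, whence the exponent n + 2 in
    \<open>?N\<close>.\<close>
  have scale: "v (t *\<^sub>R x) * w (t *\<^sub>R x) = t\<^sup>2 * (v x * w (t *\<^sub>R x))" if "t > 0" for t x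
    using v(2) that by (simp add: homogeneous_deg2_def)
  have intc: "integrable lebesgue (\<lambda>x. v x * w (c k *\<^sub>R x))" for k
    using integral_lebesgue_scaleR(2)[OF _ _ int0, of "c k"] c[of k] by (simp add: scale)
  have inv: "(\<integral>x. v x * q k x \<partial>lebesgue) = 0" for k
  proof -
    have "(\<integral>x. v x * w x \<partial>lebesgue) = c k ^ CARD('n) * ((c k)\<^sup>2 * (\<integral>x. v x * w (c k *\<^sub>R x) \<partial>lebesgue))"
      using integral_lebesgue_scaleR(1)[of "c k" "\<lambda>x. v x * w x"] c[of k] by (simp add: scale)
    then have *: "(\<integral>x. v x * w x \<partial>lebesgue) = c k ^ ?N * (\<integral>x. v x * w (c k *\<^sub>R x) \<partial>lebesgue)"
      by (simp add: power_add power2_eq_square)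
    have "(\<integral>x. v x * q k x \<partial>lebesgue) =
      (\<integral>x. real (Suc k) * (c k ^ ?N * (v x * w (c k *\<^sub>R x)) - v x * w x) \<partial>lebesgue)"
      by (intro Bochner_Integration.integral_cong) (auto simp: q_def algebra_simps)
    also have "\<dots> = real (Suc k) * (c k ^ ?N * (\<integral>x. v x * w (c k *\<^sub>R x) \<partial>lebesgue) - (\<integral>x. v x * w x \<partial>lebesgue))"
      using int0 intc[of k] by simp
    also have "\<dots> = 0" using * by simp
    finally show ?thesis .
  qed
  have "(\<lambda>k. \<integral>x. v x * q k x \<partial>lebesgue) \<longlonglongrightarrow> (\<integral>x. v x * z x \<partial>lebesgue)"
  proof (rule integral_dominated_convergence)
    \<comment> \<open>The dominating function comes from the mean value theorem: an intermediate t <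
      c k \<le> 2 gives |q k| \<le> 2^(n+1) C on the ball, and q k vanishes outside.\<close>
    show "integrable lebesgue (\<lambda>x. 2 ^ (?N - 1) * C * (indicator (cball 0 R) x * \<bar>v x\<bar>))"
      using L2_loc_integrable_cball[OF v(1)] by simp
    show "AE x in lebesgue. (\<lambda>k. v x * q k x) \<longlonglongrightarrow> v x * z x"
    proof (intro AE_I2 tendsto_mult tendsto_const)
      fix x
      have "((\<lambda>h. ((1 + h) ^ ?N * w ((1 + h) *\<^sub>R x) - 1 ^ ?N * w (1 *\<^sub>R x)) / h) \<longlongrightarrow> z x) (at 0)"
        using deriv[of x 1] by (simp add: DERIV_def)
      moreover have "filterlim (\<lambda>k. 1 / real (Suc k)) (at 0) sequentially"
        unfolding filterlim_at using LIMSEQ_Suc[OF lim_1_over_n] by auto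
      ultimately have "(\<lambda>k. ((1 + 1 / real (Suc k)) ^ ?N * w ((1 + 1 / real (Suc k)) *\<^sub>R x) - 1 ^ ?N * w (1 *\<^sub>R x))
          / (1 / real (Suc k))) \<longlonglongrightarrow> z x"
        by (rule filterlim_compose)
      then show "(\<lambda>k. q k x) \<longlonglongrightarrow> z x"
        by (simp add: q_def c_def mult.commute del: of_nat_Suc power_Suc power_add)
    qed
    show "AE x in lebesgue. norm (v x * q k x) \<le> 2 ^ (?N - 1) * C * (indicator (cball 0 R) x * \<bar>v x\<bar>)" for k
    proof (intro AE_I2)
      fix x
      show "norm (v x * q k x) \<le> 2 ^ (?N - 1) * C * (indicator (cball 0 R) x * \<bar>v x\<bar>)"
      proof (cases "norm x > R")
        case True
        then have "norm (c k *\<^sub>R x) > R"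
          using c[of k] mult_right_mono[of 1 "c k" "norm x"] by simp
        then show ?thesis using True R(2) C0 by (simp add: q_def)
      next
        case False
        obtain t where t: "1 < t" "t < c k"
          "c k ^ ?N * w (c k *\<^sub>R x) - 1 ^ ?N * w (1 *\<^sub>R x) = (c k - 1) * (t ^ (?N - 1) * z (t *\<^sub>R x))"
          using MVT2[OF c(1)[of k], of "\<lambda>c. c ^ ?N * w (c *\<^sub>R x)" "\<lambda>t. t ^ (?N - 1) * z (t *\<^sub>R x)"]
            deriv by blast
        have "q k x = t ^ (?N - 1) * z (t *\<^sub>R x)"
          using t(3) by (simp add: q_def c_def del: of_nat_Suc power_Suc power_add)
        moreover have "\<bar>t ^ (?N - 1) * z (t *\<^sub>R x)\<bar> \<le> 2 ^ (?N - 1) * C"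
          unfolding abs_mult power_abs using t c[of k] C
          by (intro mult_mono power_mono) auto
        ultimately have "\<bar>v x\<bar> * \<bar>q k x\<bar> \<le> \<bar>v x\<bar> * (2 ^ (?N - 1) * C)"
          by (intro mult_left_mono) auto
        then show ?thesis using False by (simp add: abs_mult mult.commute)
      qed
    qed
    show "(\<lambda>x. v x * q k x) \<in> borel_measurable lebesgue" for k
    proof -
      have "integrable lebesgue (\<lambda>x. real (Suc k) * (c k ^ ?N * (v x * w (c k *\<^sub>R x)) - v x * w x))"
        using int0 intc[of k] by simp
      also have "(\<lambda>x. real (Suc k) * (c k ^ ?N * (v x * w (c k *\<^sub>R x)) - v x * w x)) = (\<lambda>x. v x * q k x)"
        by (auto simp: q_def algebra_simps)
      finally show ?thesis by (rule borel_measurable_integrable)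
    qed
  qed measurable
  then have "(\<integral>x. v x * z x \<partial>lebesgue) = 0"
    by (simp add: inv LIMSEQ_const_iff)
  then show ?thesis by (simp add: z_def)
qed

subsection \<open>The angular equation in weak form\<close>

lemma partial_deriv_add_fun:
  "smooth f \<Longrightarrow> smooth g \<Longrightarrow>
    partial_deriv i (\<lambda>x. f x + g x) = (\<lambda>x. partial_deriv i f x + partial_deriv i g x)"
  by (intro ext partial_deriv_add smooth_differentiable)

lemma partial_deriv_mult_fun:
  "smooth f \<Longrightarrow> smooth g \<Longrightarrow>
    partial_deriv i (\<lambda>x. f x * g x) = (\<lambda>x. f x * partial_deriv i g x + partial_deriv i f x * g x)"
  by (intro ext partial_deriv_mult smooth_differentiable)

lemma partial_deriv_minus_fun:
  "smooth f \<Longrightarrow> partial_deriv i (\<lambda>x. - f x) = (\<lambda>x. - partial_deriv i f x)"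
  using partial_deriv_mult_fun[OF smooth_const[of "- 1"], of f i]
  by (simp add: partial_deriv_const)

lemma partial_deriv_diff_fun:
  assumes "smooth f" "smooth g"
  shows "partial_deriv i (\<lambda>x. f x - g x) = (\<lambda>x. partial_deriv i f x - partial_deriv i g x)"
  using partial_deriv_add_fun[OF assms(1) smooth_minus[OF assms(2)], of i]
  by (simp add: partial_deriv_minus_fun assms)

lemmas partial_deriv_fun_simps =
  partial_deriv_add_fun partial_deriv_mult_fun partial_deriv_diff_fun partial_deriv_minus_fun
  partial_deriv_const[abs_def] partial_deriv_coord[abs_def]

text \<open>The derivative in the polar angle, written in Cartesian coordinates.\<close>

definition rot_deriv :: "(real^2 \<Rightarrow> real) \<Rightarrow> real^2 \<Rightarrow> real" where
  "rot_deriv f x = x $ 1 * partial_deriv 2 f x - x $ 2 * partial_deriv 1 f x"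

lemma smooth_rot_deriv [smooth_intros]: "smooth f \<Longrightarrow> smooth (rot_deriv f)"
  unfolding rot_deriv_def[abs_def] by (intro smooth_intros)

lemma test_function_rot_deriv: "test_function f \<Longrightarrow> test_function (rot_deriv f)"
  unfolding rot_deriv_def[abs_def]
  by (intro test_function_diff test_function_mult test_function_partial_deriv smooth_intros)

text \<open>\<open>\<partial>\<^sub>i\<partial>\<^sub>j(|x|\<^sup>2 a\<^sub>i\<^sub>j G)\<close>, up to an Euler expression \<open>4w + x \<cdot> \<nabla>w\<close> with
  \<open>w = x \<cdot> \<nabla>G - \<epsilon> G\<close>, is a constant coefficient operator in the angular variable.\<close>

lemma double_divergence_identity:
  fixes G :: "real^2 \<Rightarrow> real" and \<epsilon> :: real
  assumes G: "smooth G"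
  defines "w \<equiv> (\<lambda>x. x $ 1 * partial_deriv 1 G x + x $ 2 * partial_deriv 2 G x - \<epsilon> * G x)"
  shows
   "partial_deriv 1 (partial_deriv 1 (\<lambda>x. ((x $ 1)\<^sup>2 + (1 + \<epsilon>) * (x $ 2)\<^sup>2) * G x)) x
    + partial_deriv 1 (partial_deriv 2 (\<lambda>x. ((- \<epsilon>) * x $ 1 * x $ 2) * G x)) x
    + partial_deriv 2 (partial_deriv 1 (\<lambda>x. ((- \<epsilon>) * x $ 1 * x $ 2) * G x)) x
    + partial_deriv 2 (partial_deriv 2 (\<lambda>x. ((1 + \<epsilon>) * (x $ 1)\<^sup>2 + (x $ 2)\<^sup>2) * G x)) x
   = (1 + \<epsilon>) * rot_deriv (rot_deriv G) x + (4 + 2 * \<epsilon>) * G x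
    + (4 * w x + (x $ 1 * partial_deriv 1 w x + x $ 2 * partial_deriv 2 w x))"
  \<comment> \<open>Each of the two mixed derivatives of G has coefficient -\<epsilon> x_1 x_2 on
    both sides, so the product rule and a comparison of coefficients settle the identity.\<close>
  unfolding w_def rot_deriv_def[abs_def] power2_eq_square
  by (simp add: partial_deriv_fun_simps G smooth_intros) (simp add: algebra_simps)

text \<open>Multiplying by |x|^2 removes the singularity at the origin: the entries become quadratic
  polynomials, admissible factors of a smooth test function.\<close>

lemma coeff_matrix_scaled:
  "(norm x)\<^sup>2 * coeff_matrix \<epsilon> x $ 1 $ 1 = (x $ 1)\<^sup>2 + (1 + \<epsilon>) * (x $ 2)\<^sup>2"
  "(norm x)\<^sup>2 * coeff_matrix \<epsilon> x $ 1 $ 2 = (- \<epsilon>) * x $ 1 * x $ 2"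
  "(norm x)\<^sup>2 * coeff_matrix \<epsilon> x $ 2 $ 1 = (- \<epsilon>) * x $ 1 * x $ 2"
  "(norm x)\<^sup>2 * coeff_matrix \<epsilon> x $ 2 $ 2 = (1 + \<epsilon>) * (x $ 1)\<^sup>2 + (x $ 2)\<^sup>2"
proof -
  have n: "(norm x)\<^sup>2 = (x $ 1)\<^sup>2 + (x $ 2)\<^sup>2"
    unfolding power2_norm_eq_inner by (simp add: inner_vec_def sum_2 power2_eq_square)
  show "(norm x)\<^sup>2 * coeff_matrix \<epsilon> x $ 1 $ 1 = (x $ 1)\<^sup>2 + (1 + \<epsilon>) * (x $ 2)\<^sup>2"
    "(norm x)\<^sup>2 * coeff_matrix \<epsilon> x $ 1 $ 2 = (- \<epsilon>) * x $ 1 * x $ 2"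
    "(norm x)\<^sup>2 * coeff_matrix \<epsilon> x $ 2 $ 1 = (- \<epsilon>) * x $ 1 * x $ 2"
    "(norm x)\<^sup>2 * coeff_matrix \<epsilon> x $ 2 $ 2 = (1 + \<epsilon>) * (x $ 1)\<^sup>2 + (x $ 2)\<^sup>2"
    \<comment> \<open>At x = 0 the default value of division is harmless, as both sides are
      0.\<close>
    by (cases "x = 0"; simp add: coeff_matrix_def distrib_left; simp add: n algebra_simps)+
qed

text \<open>Test the equation with |x|^2 G, so that the coefficients are polynomials, and move both
  derivatives off v. By \<open>double_divergence_identity\<close> the result is the angular operator
  applied to G plus an Euler expression, whose integral against v is 0 by homogeneity.\<close>

lemma weak_angular_equation:
  assumes sol: "strong_solution (coeff_matrix \<epsilon>) v" and hom: "homogeneous_deg2 v"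
    and G: "test_function G"
  shows "(\<integral>x. v x * ((1 + \<epsilon>) * rot_deriv (rot_deriv G) x + (4 + 2 * \<epsilon>) * G x) \<partial>lebesgue)
    = (\<integral>x. indicator {y. v y > 0} x * ((norm x)\<^sup>2 * G x) \<partial>lebesgue)"
proof -
  obtain D H where W: "W22_loc_with v D H"
    and eq: "AE x in lebesgue. (\<Sum>i\<in>UNIV. \<Sum>j\<in>UNIV. coeff_matrix \<epsilon> x $ i $ j * H i j x) = indicator {y. v y > 0} x"
    using sol unfolding strong_solution_def by blast
  have v: "L2_loc v" and H: "L2_loc (H i j)" for i j
    using W by (auto simp: W22_loc_with_def)
  define a where "a = (\<lambda>x::real^2. ((x $ 1)\<^sup>2 + (1 + \<epsilon>) * (x $ 2)\<^sup>2) * G x)"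
  define b where "b = (\<lambda>x::real^2. ((- \<epsilon>) * x $ 1 * x $ 2) * G x)"
  define c where "c = (\<lambda>x::real^2. ((1 + \<epsilon>) * (x $ 1)\<^sup>2 + (x $ 2)\<^sup>2) * G x)"
  define w where "w = (\<lambda>x. x $ 1 * partial_deriv 1 G x + x $ 2 * partial_deriv 2 G x - \<epsilon> * G x)"
  have ta: "test_function a" and tb: "test_function b" and tc: "test_function c"
    unfolding a_def b_def c_def by (intro test_function_mult smooth_intros G)+
  have tw: "test_function w"
    unfolding w_def by (intro test_function_diff test_function_add test_function_mult
        test_function_partial_deriv smooth_intros G)
  define F where "F = (\<lambda>x. (1 + \<epsilon>) * rot_deriv (rot_deriv G) x + (4 + 2 * \<epsilon>) * G x)"
  define E where "E = (\<lambda>x. 4 * w x + (x $ 1 * partial_deriv 1 w x + x $ 2 * partial_deriv 2 w x))"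
  have tF: "test_function F"
    unfolding F_def by (intro test_function_add test_function_mult test_function_rot_deriv smooth_intros G)
  have tE: "test_function E"
    unfolding E_def by (intro test_function_add test_function_mult test_function_partial_deriv smooth_intros tw)
  note int = integrable_L2_loc_test[OF v] integrable_L2_loc_test[OF H] test_function_partial_deriv
  \<comment> \<open>In the plane n + 2 = 4, which is the factor of w in \<open>E\<close>.\<close>
  have E: "(\<integral>x. v x * E x \<partial>lebesgue) = 0"
    using homogeneous_weak_Euler[OF v hom tw] by (simp add: E_def sum_2)
  have [measurable]: "v \<in> borel_measurable lebesgue" "H i j \<in> borel_measurable lebesgue" for i j
    using v H by (auto simp: L2_loc_def)
  have [measurable]: "a \<in> borel_measurable lebesgue" "b \<in> borel_measurable lebesgue"
    "c \<in> borel_measurable lebesgue" "G \<in> borel_measurable lebesgue"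
    using ta tb tc G by (simp_all add: smooth_measurable test_function_smooth)
  have [measurable]: "(norm :: real^2 \<Rightarrow> real) \<in> borel_measurable lebesgue"
    by (rule measurable_completion) simp
  have "(\<integral>x. indicator {y. v y > 0} x * ((norm x)\<^sup>2 * G x) \<partial>lebesgue)
      = (\<integral>x. H 1 1 x * a x + H 1 2 x * b x + H 2 1 x * b x + H 2 2 x * c x \<partial>lebesgue)"
  proof (rule integral_cong_AE)
    show "AE x in lebesgue. indicator {y. v y > 0} x * ((norm x)\<^sup>2 * G x)
      = H 1 1 x * a x + H 1 2 x * b x + H 2 1 x * b x + H 2 2 x * c x"
      using eq
    proof eventually_elim
      case (elim x)
      have "indicator {y. v y > 0} x * ((norm x)\<^sup>2 * G x) =
         (\<Sum>i\<in>UNIV. \<Sum>j\<in>UNIV. coeff_matrix \<epsilon> x $ i $ j * H i j x) * ((norm x)\<^sup>2 * G x)"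
        using elim by simp
      also have "\<dots> = H 1 1 x * (((norm x)\<^sup>2 * coeff_matrix \<epsilon> x $ 1 $ 1) * G x)
         + H 1 2 x * (((norm x)\<^sup>2 * coeff_matrix \<epsilon> x $ 1 $ 2) * G x)
         + H 2 1 x * (((norm x)\<^sup>2 * coeff_matrix \<epsilon> x $ 2 $ 1) * G x)
         + H 2 2 x * (((norm x)\<^sup>2 * coeff_matrix \<epsilon> x $ 2 $ 2) * G x)"
        by (simp add: sum_2 algebra_simps)
      finally show ?case
        unfolding coeff_matrix_scaled a_def b_def c_def .
    qed
  qed measurable
  also have "\<dots> = (\<integral>x. v x * partial_deriv 1 (partial_deriv 1 a) x \<partial>lebesgue)
      + (\<integral>x. v x * partial_deriv 1 (partial_deriv 2 b) x \<partial>lebesgue)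
      + (\<integral>x. v x * partial_deriv 2 (partial_deriv 1 b) x \<partial>lebesgue)
      + (\<integral>x. v x * partial_deriv 2 (partial_deriv 2 c) x \<partial>lebesgue)"
    by (simp add: int ta tb tc weak_second_partial[OF W, symmetric])
  also have "\<dots> = (\<integral>x. v x * (partial_deriv 1 (partial_deriv 1 a) x
      + partial_deriv 1 (partial_deriv 2 b) x + partial_deriv 2 (partial_deriv 1 b) x
      + partial_deriv 2 (partial_deriv 2 c) x) \<partial>lebesgue)"
    by (simp add: int ta tb tc distrib_left)
  also have "\<dots> = (\<integral>x. v x * F x + v x * E x \<partial>lebesgue)"
    unfolding a_def b_def c_def double_divergence_identity[OF test_function_smooth[OF G]]
    by (simp add: F_def E_def w_def distrib_left)
  also have "\<dots> = (\<integral>x. v x * F x \<partial>lebesgue)"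
    by (simp add: int tF tE E)
  finally show ?thesis by (simp add: F_def)
qed

subsection \<open>Orthogonal invariance and the positivity set\<close>

lemma integral_lebesgue_orthogonal:
  fixes f :: "real^'n::{finite,wellorder} \<Rightarrow> real" and T :: "real^'n::_ \<Rightarrow> real^'n::_"
  assumes T: "orthogonal_transformation T" and f: "integrable lebesgue f"
  shows "integrable lebesgue (\<lambda>x. f (T x))"
    and "(\<integral>x. f (T x) \<partial>lebesgue) = (\<integral>x. f x \<partial>lebesgue)"
proof -
  have lin: "linear T" using T by (simp add: orthogonal_transformation_linear)
  have surj: "range T = UNIV" by (rule orthogonal_transformation_surj[OF T])
  have det: "\<bar>det (matrix T)\<bar> = 1" using T by simp
  \<comment> \<open>Lifted to \<open>real^1\<close>, because the linear change of variables used
    here is stated for vector-valued functions.\<close>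
  define g where "g = (\<lambda>x. vec (f x) :: real^1)"
  have g: "g absolutely_integrable_on (T ` UNIV)"
    using f unfolding surj g_def absolutely_integrable_on_1_iff by (simp add: set_integrable_def)
  have gT: "(g \<circ> T) absolutely_integrable_on UNIV"
    using absolutely_integrable_on_linear_image[OF lin, where f = g and S = UNIV] g det by auto
  then show fT: "integrable lebesgue (\<lambda>x. f (T x))"
    unfolding g_def absolutely_integrable_on_1_iff by (simp add: set_integrable_def)
  have "integral UNIV g = integral UNIV (g \<circ> T)"
    using integral_change_of_variables_linear[OF lin disjI1[OF g]] by (simp add: surj det)
  then have "integral UNIV f = integral UNIV (\<lambda>x. f (T x))"
    by (simp add: integral_on_1_eq g_def vec_eq_iff)
  then show "(\<integral>x. f (T x) \<partial>lebesgue) = (\<integral>x. f x \<partial>lebesgue)"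
    using f fT by (simp add: integral_lebesgue)
qed

lemma AE_not_on_line:
  assumes "e \<noteq> 0"
  shows "AE x in lebesgue. x \<bullet> (e::'a::euclidean_space) \<noteq> 0"
proof -
  have "negligible {x. e \<bullet> x = 0}"
    using negligible_hyperplane[of e 0] assms by simp
  then have "{x. e \<bullet> x = 0} \<in> null_sets lebesgue"
    by (simp add: negligible_iff_null_sets)
  then have "AE x in lebesgue. x \<notin> {x. e \<bullet> x = 0}"
    by (rule AE_not_in)
  then show ?thesis by (simp add: inner_commute)
qed

lemma half_plane_measurable [measurable]: "{x. x \<bullet> (e::'a::euclidean_space) > 0} \<in> sets lebesgue"
  by (intro borel_open[THEN sets_completionI_sets[where M = lborel, simplified]] open_Collect_less continuous_intros)

text \<open>The point reflection exchanges the two open half spaces, and the hyperplane between them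
  is a null set.\<close>

lemma integral_half_plane_even:
  fixes f :: "real^'n::{finite,wellorder} \<Rightarrow> real"
  assumes "e \<noteq> 0" "integrable lebesgue f" "\<And>x. f (- x) = f x"
  shows "(\<integral>x. indicator {x. x \<bullet> e > 0} x * f x \<partial>lebesgue) = (\<integral>x. f x \<partial>lebesgue) / 2"
proof -
  let ?g = "\<lambda>x. indicator {x. x \<bullet> e > 0} x * f x"
  have g: "integrable lebesgue ?g"
    using integrable_mult_indicator[OF half_plane_measurable assms(2)] by simp
  have T: "orthogonal_transformation (uminus :: real^'n::{finite,wellorder} \<Rightarrow> _)"
    by (simp add: orthogonal_transformation_def linear_uminus)
  note gT = integral_lebesgue_orthogonal[OF T g]
  have [measurable]: "f \<in> borel_measurable lebesgue" using assms(2) by simp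
  have "(\<integral>x. f x \<partial>lebesgue) = (\<integral>x. ?g x + ?g (- x) \<partial>lebesgue)"
  proof (rule integral_cong_AE)
    show "AE x in lebesgue. f x = ?g x + ?g (- x)"
      using AE_not_on_line[OF assms(1)] by eventually_elim (auto simp: indicator_def assms(3))
    show "(\<lambda>x. ?g x + ?g (- x)) \<in> borel_measurable lebesgue"
      using g gT(1) by (intro borel_measurable_add) auto
  qed simp
  also have "\<dots> = 2 * (\<integral>x. ?g x \<partial>lebesgue)"
    using Bochner_Integration.integral_add[OF g gT(1)] gT(2) by simp
  finally show ?thesis by simp
qed

text \<open>Applied below to a quarter turn and to an eighth turn, which change the sign of cos
  2\<theta> and of cos 4\<theta>.\<close>

lemma integral_odd_orthogonal:
  fixes f :: "real^'n::{finite,wellorder} \<Rightarrow> real"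
  assumes "orthogonal_transformation T" "integrable lebesgue f" "\<And>x. f (T x) = - f x"
  shows "(\<integral>x. f x \<partial>lebesgue) = 0"
  using integral_lebesgue_orthogonal(2)[OF assms(1,2)] by (simp add: assms(3))

text \<open>The shift by \<open>- 1\<close> turns the weight \<open>sqrt (1 + t) ^ n\<close> of \<^const>\<open>flat\<close> into \<open>|x|\<^sup>n\<close>.\<close>

definition annular :: "nat \<Rightarrow> real^'n::finite \<Rightarrow> real" where
  "annular n x = flat 0 n (- 1 + 1 * (norm x)\<^sup>2) * flat 0 0 (4 + (- 1) * (norm x)\<^sup>2)"

lemma smooth_annular [smooth_intros]: "smooth (annular n)"
  unfolding annular_def[abs_def] by (intro smooth_intros)

text \<open>For |x| > 1 the weight is sqrt (1 + (|x|^2 - 1))^n = |x|^n, and elsewhere both sides are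
  0. Thus a homogeneous polynomial of degree n times \<open>annular n\<close> is a function of the
  angle times the common radial profile \<open>annular 0\<close>.\<close>

lemma annular_eq: "annular n x = annular 0 x / norm x ^ n"
  by (simp add: annular_def flat_def)

lemma annular_le_1: "norm x \<le> 1 \<Longrightarrow> annular n x = 0"
  using power_le_one[of "norm x" 2] by (simp add: annular_def flat_def)

lemma annular_nonneg: "annular n x \<ge> 0"
  by (simp add: annular_def flat_nonneg)

lemma annular_pos: "1 < norm x \<Longrightarrow> norm x < 2 \<Longrightarrow> annular n x > 0"
  using power_strict_mono[of 1 "norm x" 2] power_strict_mono[of "norm x" 2 2]
  by (auto simp: annular_def flat_def intro!: divide_pos_pos mult_pos_pos zero_less_power)

lemma test_function_annular: "test_function (annular n)"
proof (rule test_functionI[where R = 2])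
  fix x :: "real^'a"
  assume "norm x > 2"
  then have "(norm x)\<^sup>2 > 2\<^sup>2" by (intro power_strict_mono) auto
  then show "annular n x = 0" by (simp add: annular_def flat_def)
qed (rule smooth_annular)

text \<open>The gradient of a radial function is parallel to x, so it has no angular
  component.\<close>

lemma rot_deriv_annular: "rot_deriv (annular n) = (\<lambda>x. 0)"
proof
  fix x :: "real^2"
  show "rot_deriv (annular n) x = 0"
    unfolding annular_def[abs_def] rot_deriv_def
    by (simp only: partial_deriv_mult_fun smooth_flat partial_deriv_radial(2)[OF flat_has_derivative])
      (simp add: algebra_simps)
qed

lemma rot_deriv_mult:
  "smooth f \<Longrightarrow> smooth g \<Longrightarrow> rot_deriv (\<lambda>x. f x * g x) = (\<lambda>x. f x * rot_deriv g x + rot_deriv f x * g x)"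
  by (simp add: rot_deriv_def partial_deriv_mult_fun fun_eq_iff algebra_simps)

lemma rot_deriv_annular_mult:
  assumes "smooth p"
  shows "rot_deriv (rot_deriv (\<lambda>x. p x * annular n x)) = (\<lambda>x. rot_deriv (rot_deriv p) x * annular n x)"
  by (simp add: rot_deriv_mult assms smooth_intros rot_deriv_annular)


section \<open>Angular eigenfunctions, plane rotations and the half plane of positivity\<close>

lemma norm_square_2: "(norm (x::real^2))\<^sup>2 = (x $ 1)\<^sup>2 + (x $ 2)\<^sup>2"
  unfolding power2_norm_eq_inner by (simp add: inner_vec_def sum_2 power2_eq_square)

lemma inner_2: "(x::real^2) \<bullet> y = x $ 1 * y $ 1 + x $ 2 * y $ 2"
  by (simp add: inner_vec_def sum_2)

text \<open>For a unit vector e this is the harmonic r cos \<theta>, with \<theta> measured from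
  e.\<close>

lemma rot_deriv_linear:
  "rot_deriv (rot_deriv (\<lambda>x. x $ 1 * e $ 1 + x $ 2 * e $ 2)) =
    (\<lambda>x. - 1 * (x $ 1 * e $ 1 + x $ 2 * (e::real^2) $ 2))"
  unfolding rot_deriv_def[abs_def]
  by (simp add: partial_deriv_fun_simps smooth_intros)

text \<open>This is r^2 cos 2\<theta>, with \<theta> measured from e; the unit length of e makes the
  subtracted |x|^2 cancel the radial part of 2 (x \<bullet> e)^2.\<close>

lemma rot_deriv_quadratic:
  assumes "norm (e::real^2) = 1"
  shows "rot_deriv (rot_deriv (\<lambda>x. 2 * (x $ 1 * e $ 1 + x $ 2 * e $ 2)\<^sup>2 - ((x $ 1)\<^sup>2 + (x $ 2)\<^sup>2))) =
    (\<lambda>x. - 4 * (2 * (x $ 1 * e $ 1 + x $ 2 * e $ 2)\<^sup>2 - ((x $ 1)\<^sup>2 + (x $ 2)\<^sup>2)))"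
proof
  fix x :: "real^2"
  have e: "e $ 1 * e $ 1 + e $ 2 * e $ 2 = 1"
    using norm_square_2[of e] assms by (simp add: power2_eq_square)
  show "rot_deriv (rot_deriv (\<lambda>x. 2 * (x $ 1 * e $ 1 + x $ 2 * e $ 2)\<^sup>2 - ((x $ 1)\<^sup>2 + (x $ 2)\<^sup>2))) x =
    - 4 * (2 * (x $ 1 * e $ 1 + x $ 2 * e $ 2)\<^sup>2 - ((x $ 1)\<^sup>2 + (x $ 2)\<^sup>2))"
    unfolding rot_deriv_def[abs_def] power2_eq_square
    by (simp add: partial_deriv_fun_simps smooth_intros) (use e in algebra)
qed

lemma orthogonal_transformation_2:
  assumes "a\<^sup>2 + b\<^sup>2 = 1"
  shows "orthogonal_transformation (\<lambda>x::real^2. vector [a * x $ 1 - b * x $ 2, b * x $ 1 + a * x $ 2] :: real^2)"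
  unfolding orthogonal_transformation_def
proof (intro conjI allI)
  show "linear (\<lambda>x::real^2. vector [a * x $ 1 - b * x $ 2, b * x $ 1 + a * x $ 2] :: real^2)"
    by (rule linearI) (auto simp: vec_eq_iff forall_2 algebra_simps)
  fix x y :: "real^2"
  show "(vector [a * x $ 1 - b * x $ 2, b * x $ 1 + a * x $ 2] :: real^2) \<bullet> 
      vector [a * y $ 1 - b * y $ 2, b * y $ 1 + a * y $ 2] = x \<bullet> y"
    using assms by (simp add: inner_2) algebra
qed

text \<open>Homogeneity makes the sign of v constant along rays, so it can be read off arbitrarily
  close to 0, where \<phi>(h) = o(h) is too small to affect the comparison with x_2. Only the line
  x_2 = 0 stays undecided, and it is null.\<close>

lemma AE_positive_half_plane:
  assumes hom: "homogeneous_deg2 v" and bd: "boundary_differentiable_at_origin {x. v x > 0}"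
  obtains e where "norm e = 1" "AE x in lebesgue. v x > 0 \<longleftrightarrow> x \<bullet> e > 0"
proof -
  obtain Q \<phi> r where r: "r > 0" and Q: "rotation_matrix Q" and \<phi>: "\<phi> 0 = 0" "(\<phi> has_real_derivative 0) (at 0)"
    and U: "\<And>x. x \<in> ball 0 r \<Longrightarrow> v (Q *v x) > 0 \<longleftrightarrow> x $ 2 < \<phi> (x $ 1)"
    using bd unfolding boundary_differentiable_at_origin_def by auto
  have oQ: "orthogonal_matrix Q" using Q by (simp add: rotation_matrix_def)
  \<comment> \<open>The rotated inward direction: x_2 < 0 becomes (Q x) \<bullet> e > 0.\<close>
  define e where "e = Q *v axis 2 (- 1)"
  have oT: "orthogonal_transformation ((*v) Q)"
    using oQ by (simp add: orthogonal_transformation_matrix)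
  have "norm e = 1"
    using orthogonal_transformation_norm[OF oT] by (simp add: e_def norm_eq_sqrt_inner inner_axis)
  have key: "v (Q *v x) > 0 \<longleftrightarrow> x $ 2 < 0" if "x $ 2 \<noteq> 0" for x
  proof -
    have "((\<lambda>h. \<phi> h / h) \<longlongrightarrow> 0) (at 0)"
      using \<phi> by (simp add: DERIV_def)
    \<comment> \<open>Threshold chosen so that h = t x_1 gives |\<phi>(t x_1)| < t |x_2|; the
      \<open>+ 1\<close> avoids a zero denominator when x_1 = 0.\<close>
    then have "\<forall>\<^sub>F h in at 0. \<bar>\<phi> h / h\<bar> < \<bar>x $ 2\<bar> / (\<bar>x $ 1\<bar> + 1)"
      using that by (auto dest!: tendstoD[where e = "\<bar>x $ 2\<bar> / (\<bar>x $ 1\<bar> + 1)"] simp: dist_real_def)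
    then obtain d where d: "d > 0" "\<And>h. h \<noteq> 0 \<Longrightarrow> \<bar>h\<bar> < d \<Longrightarrow> \<bar>\<phi> h / h\<bar> < \<bar>x $ 2\<bar> / (\<bar>x $ 1\<bar> + 1)"
      unfolding eventually_at by (auto simp: dist_real_def)
    \<comment> \<open>Brings t x into the ball of radius r and its first coordinate within d of
      0.\<close>
    define t where "t = min (r / 2) (d / 2) / (norm x + 1)"
    have t: "t > 0" using r d by (simp add: t_def add_nonneg_pos)
    have tx: "t * norm x < r" "t * norm x < d"
    proof -
      have "t * norm x \<le> t * (norm x + 1)" using t by simp
      also have "\<dots> = min (r / 2) (d / 2)" by (simp add: t_def add_nonneg_pos order_less_imp_not_eq2)
      finally show "t * norm x < r" "t * norm x < d" using r d by auto
    qed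
    have b: "\<bar>\<phi> (t * x $ 1)\<bar> < t * \<bar>x $ 2\<bar>"
    proof (cases "x $ 1 = 0")
      case True
      then show ?thesis using \<phi> t that by simp
    next
      case False
      have "t * \<bar>x $ 1\<bar> \<le> t * norm x"
        by (rule mult_left_mono[OF component_le_norm_cart less_imp_le[OF t]])
      then have "\<bar>t * x $ 1\<bar> < d"
        using tx(2) t by (simp only: abs_mult abs_of_pos)
      then have "\<bar>\<phi> (t * x $ 1) / (t * x $ 1)\<bar> < \<bar>x $ 2\<bar> / (\<bar>x $ 1\<bar> + 1)"
        using d(2) False t by simp
      then have "\<bar>\<phi> (t * x $ 1)\<bar> < \<bar>x $ 2\<bar> / (\<bar>x $ 1\<bar> + 1) * (t * \<bar>x $ 1\<bar>)"
        using False t by (simp add: abs_mult divide_less_eq)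
      also have "\<dots> \<le> t * \<bar>x $ 2\<bar>"
        using t by (simp add: divide_le_eq algebra_simps)
      finally show ?thesis .
    qed
    have "t *\<^sub>R x \<in> ball 0 r" using tx t by simp
    then have "v (Q *v (t *\<^sub>R x)) > 0 \<longleftrightarrow> t * x $ 2 < \<phi> (t * x $ 1)"
      using U by fastforce
    also have "\<dots> \<longleftrightarrow> x $ 2 < 0"
      using b t that by (cases "x $ 2 < 0") (auto simp: abs_if mult_less_0_iff split: if_splits)
    also have "v (Q *v (t *\<^sub>R x)) = t\<^sup>2 * v (Q *v x)"
      using hom t by (simp add: homogeneous_deg2_def matrix_vector_mult_scaleR)
    finally show ?thesis using t by (simp add: zero_less_mult_iff)
  qed
  have "e \<noteq> 0" using \<open>norm e = 1\<close> by auto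
  have "AE z in lebesgue. v z > 0 \<longleftrightarrow> z \<bullet> e > 0"
    using AE_not_on_line[OF \<open>e \<noteq> 0\<close>]
  proof eventually_elim
    case (elim z)
    obtain x where x: "z = Q *v x"
      using orthogonal_transformation_surj[OF oT] by (metis surjD)
    have "z \<bullet> e = - x $ 2"
      using oT by (simp add: x e_def orthogonal_transformation_def inner_axis)
    then show ?case using key[of x] elim x by auto
  qed
  with \<open>norm e = 1\<close> show ?thesis by (rule that)
qed

subsection \<open>Moments over a half plane\<close>

text \<open>With \<open>u = x \<bullet> e / |x|\<close>, rotations by \<open>\<pi>/2\<close> and \<open>\<pi>/4\<close> show that \<open>u\<^sup>2\<close> and \<open>u\<^sup>4\<close> have means \<open>1/2\<close>
  and \<open>3/8\<close>; the mean of \<open>u\<close> is bounded below by means of the quartic \<open>5/3 u\<^sup>2 - 500/729 u\<^sup>4\<close>,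
  which touches \<open>u\<close> from below at \<open>9/10\<close>.\<close>

lemma annular_moments:
  fixes e :: "real^2"
  assumes e: "norm e = 1"
  defines "K \<equiv> \<lambda>p :: real^2 \<Rightarrow> real. \<integral>x. indicator {x. x \<bullet> e > 0} x * p x \<partial>lebesgue"
  shows "K (\<lambda>x. (norm x)\<^sup>2 * annular 0 x) > 0"
    and "K (\<lambda>x. (norm x)\<^sup>2 * ((2 * (x \<bullet> e)\<^sup>2 - (norm x)\<^sup>2) * annular 2 x)) = 0"
    and "K (\<lambda>x. (norm x)\<^sup>2 * ((x \<bullet> e) * annular 1 x)) \<ge> 0.576 * K (\<lambda>x. (norm x)\<^sup>2 * annular 0 x)"
proof -
  have e0: "e \<noteq> 0" and ee: "(e $ 1)\<^sup>2 + (e $ 2)\<^sup>2 = 1"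
    using e norm_square_2[of e] by auto
  have smooth_inner: "smooth (\<lambda>x. x \<bullet> e)"
    unfolding inner_2 by (intro smooth_intros)
  have smooth_norm: "smooth (\<lambda>x::real^2. (norm x)\<^sup>2)"
    unfolding norm_square_2 by (intro smooth_intros)
  have int: "integrable lebesgue (\<lambda>x. p x * annular n x)" if "smooth p" for p :: "real^2 \<Rightarrow> real" and n
  proof -
    have "L2_loc p"
      unfolding L2_loc_def
    proof (intro conjI allI impI)
      show "p \<in> borel_measurable lebesgue" using that by (rule smooth_measurable)
      fix S :: "(real^2) set" assume "compact S"
      then have "integrable lborel (\<lambda>x. indicator S x *\<^sub>R (p x)\<^sup>2)"
        by (rule borel_integrable_compact)
          (rule continuous_on_subset[OF continuous_on_power[OF smooth_continuous[OF that]] subset_UNIV])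
      then show "set_integrable lebesgue S (\<lambda>x. (p x)\<^sup>2)"
        by (simp add: set_integrable_def integrable_completion)
    qed
    then show ?thesis by (rule integrable_L2_loc_test[OF _ test_function_annular])
  qed
  have intK: "integrable lebesgue (\<lambda>x. indicator {x. x \<bullet> e > 0} x * p x)" if "integrable lebesgue p"
    for p :: "real^2 \<Rightarrow> real"
    using integrable_mult_indicator[OF half_plane_measurable that] by simp
  \<comment> \<open>With u = cos \<theta>, the four functions \<open>F0\<close>, \<open>F1\<close>,
    \<open>F2\<close>, \<open>F4\<close> are the common weight |x|^2 \<open>annular 0\<close> times
    1, cos \<theta>, cos 2\<theta> and cos 4\<theta>, the last being the Chebyshev polynomial 8 u^4
    - 8 u^2 + 1.\<close>
  define F0 where "F0 = (\<lambda>x::real^2. (norm x)\<^sup>2 * annular 0 x)"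
  define F1 where "F1 = (\<lambda>x. ((norm x)\<^sup>2 * (x \<bullet> e)) * annular 1 x)"
  define F2 where "F2 = (\<lambda>x. ((norm x)\<^sup>2 * (2 * (x \<bullet> e)\<^sup>2 - (norm x)\<^sup>2)) * annular 2 x)"
  define F4 where "F4 = (\<lambda>x. (8 * ((x \<bullet> e)\<^sup>2)\<^sup>2 - 8 * (x \<bullet> e)\<^sup>2 * (norm x)\<^sup>2 + ((norm x)\<^sup>2)\<^sup>2) * annular 2 x)"
  have i0: "integrable lebesgue F0" and i1: "integrable lebesgue F1"
    and i2: "integrable lebesgue F2" and i4: "integrable lebesgue F4"
    unfolding F0_def F1_def F2_def F4_def by (intro int smooth_intros smooth_inner smooth_norm)+
  have even: "annular n (- x) = annular n x" for n and x :: "real^2"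
    by (simp add: annular_def)
  define R where "R = (\<lambda>a b (x::real^2). vector [a * x $ 1 - b * x $ 2, b * x $ 1 + a * x $ 2] :: real^2)"
  have oR: "orthogonal_transformation (R a b)" if "a\<^sup>2 + b\<^sup>2 = 1" for a b
    unfolding R_def by (rule orthogonal_transformation_2[OF that])
  have nR: "norm (R a b x) = norm x" if "a\<^sup>2 + b\<^sup>2 = 1" for a b x
    by (rule orthogonal_transformation_norm[OF oR[OF that]])
  have aR: "annular n (R a b x) = annular n x" if "a\<^sup>2 + b\<^sup>2 = 1" for n a b x
    by (simp add: annular_def nR[OF that])
  have K2: "K F2 = 0"
  proof -
    have r: "(0::real)\<^sup>2 + 1\<^sup>2 = 1" by simp
    \<comment> \<open>A quarter turn replaces the component along e by the orthogonal one, up to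
      sign, so u^2 becomes 1 - u^2.\<close>
    have "F2 (R 0 1 x) = - F2 x" for x
    proof -
      have "(R 0 1 x \<bullet> e)\<^sup>2 = (norm x)\<^sup>2 - (x \<bullet> e)\<^sup>2"
        using ee unfolding R_def norm_square_2 inner_2 by simp algebra
      then show ?thesis
        unfolding F2_def nR[OF r] aR[OF r] by (simp only:) (simp add: algebra_simps)
    qed
    then have "(\<integral>x. F2 x \<partial>lebesgue) = 0"
      by (rule integral_odd_orthogonal[OF oR[OF r] i2])
    then show ?thesis
      unfolding K_def by (subst integral_half_plane_even[OF e0 i2]) (auto simp: F2_def even)
  qed
  have K4: "K F4 = 0"
  proof -
    have r: "(sqrt (1/2))\<^sup>2 + (sqrt (1/2))\<^sup>2 = (1::real)" by simp
    have "F4 (R (sqrt (1/2)) (sqrt (1/2)) x) = - F4 x" for x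
    proof -
      \<comment> \<open>Components of x in an orthonormal frame containing e; the eighth turn sends
        y to (y + z) / sqrt 2.\<close>
      define y where "y = x \<bullet> e"
      define z where "z = x $ 1 * e $ 2 - x $ 2 * e $ 1"
      have yz: "(norm x)\<^sup>2 = y\<^sup>2 + z\<^sup>2"
        using ee unfolding y_def z_def norm_square_2 inner_2 by algebra
      have "R (sqrt (1/2)) (sqrt (1/2)) x \<bullet> e = sqrt (1/2) * (y + z)"
        unfolding R_def y_def z_def inner_2 by (simp add: algebra_simps)
      then have q: "(R (sqrt (1/2)) (sqrt (1/2)) x \<bullet> e)\<^sup>2 = (y + z)\<^sup>2 / 2"
        by (simp add: power_mult_distrib)
      have "8 * ((y + z)\<^sup>2 / 2)\<^sup>2 - 8 * ((y + z)\<^sup>2 / 2) * (y\<^sup>2 + z\<^sup>2) + (y\<^sup>2 + z\<^sup>2)\<^sup>2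
          = - (8 * (y\<^sup>2)\<^sup>2 - 8 * y\<^sup>2 * (y\<^sup>2 + z\<^sup>2) + (y\<^sup>2 + z\<^sup>2)\<^sup>2)"
        by (simp add: power2_eq_square field_simps)
      then show ?thesis
        unfolding F4_def nR[OF r] aR[OF r] q yz y_def[symmetric] by (simp only: mult_minus_left)
    qed
    then have "(\<integral>x. F4 x \<partial>lebesgue) = 0"
      by (rule integral_odd_orthogonal[OF oR[OF r] i4])
    then show ?thesis
      unfolding K_def by (subst integral_half_plane_even[OF e0 i4]) (auto simp: F4_def even)
  qed
  have F0_nonneg: "F0 x \<ge> 0" for x by (simp add: F0_def annular_nonneg)
  have K0: "K F0 > 0"
  proof -
    \<comment> \<open>\<open>F0\<close> is positive on the annulus 1 < |x| < 2, a nonempty open set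
      and hence not null.\<close>
    have "\<not> (AE x in lebesgue. F0 x = 0)"
    proof
      assume "AE x in lebesgue. F0 x = 0"
      then have "AE x in lebesgue. x \<notin> ball 0 2 - cball (0::real^2) 1"
        by eventually_elim (use annular_pos[where n = 0] in \<open>force simp: F0_def\<close>)
      then have "negligible (ball 0 2 - cball (0::real^2) 1)"
        by (simp add: negligible_iff_null_sets AE_iff_null_sets)
      moreover have "open (ball 0 2 - cball (0::real^2) 1)" by (simp add: open_Diff)
      moreover have "(3/2) *\<^sub>R e \<in> ball 0 2 - cball (0::real^2) 1" by (simp add: e)
      ultimately show False using open_not_negligible by blast
    qed
    then have "(\<integral>x. F0 x \<partial>lebesgue) \<noteq> 0"
      using integral_nonneg_eq_0_iff_AE[OF i0] F0_nonneg by simp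
    moreover have "(\<integral>x. F0 x \<partial>lebesgue) \<ge> 0" using F0_nonneg by simp
    ultimately show ?thesis
      unfolding K_def by (subst integral_half_plane_even[OF e0 i0]) (auto simp: F0_def even)
  qed
  \<comment> \<open>The coefficients expand the quartic in harmonics, by u^2 = (1 + cos 2\<theta>) /
    2 and u^4 = (3 + 4 cos 2\<theta> + cos 4\<theta>) / 8.\<close>
  have "indicator {x. x \<bullet> e > 0} x * F1 x \<ge> indicator {x. x \<bullet> e > 0} x *
      ((5/6 - 125/486) * F0 x + (5/6 - 250/729) * F2 x - 125/1458 * F4 x)" for x
  proof (cases "x \<bullet> e > 0 \<and> norm x > 1")
    case True
    define s where "s = norm x"
    define u where "u = (x \<bullet> e) / s"
    have s: "s > 1" using True by (simp add: s_def)
    have u: "u > 0" using True s by (simp add: u_def)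
    have y: "x \<bullet> e = s * u" using s by (simp add: u_def)
    \<comment> \<open>A double root at 9/10 for tangency, a root at 0, and the root -9/5 so that the
      cubic term vanishes. The contact point is a rational close to sqrt 3 / 2, where the resulting
      bound on the mean is largest.\<close>
    have "u * (u - 9/10)\<^sup>2 * (u + 9/5) \<ge> 0" using u by simp
    moreover have "u * (u - 9/10)\<^sup>2 * (u + 9/5) = u^4 - 243/100 * u\<^sup>2 + 729/500 * u"
      by (simp add: power2_eq_square power4_eq_xxxx field_simps)
    ultimately have ineq: "u \<ge> 5/3 * u\<^sup>2 - 500/729 * u^4" by linarith
    have F: "F0 x = s\<^sup>2 * annular 0 x" "F1 x = s\<^sup>2 * annular 0 x * u"
      "F2 x = s\<^sup>2 * annular 0 x * (2 * u\<^sup>2 - 1)"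
      "F4 x = s\<^sup>2 * annular 0 x * (8 * u^4 - 8 * u\<^sup>2 + 1)"
      unfolding F0_def F1_def F2_def F4_def y s_def[symmetric]
        annular_eq[of 1 x, unfolded s_def[symmetric]] annular_eq[of 2 x, unfolded s_def[symmetric]]
      using s by (simp_all add: field_simps power2_eq_square power4_eq_xxxx)
    have "(5/6 - 125/486) * F0 x + (5/6 - 250/729) * F2 x - 125/1458 * F4 x
        = s\<^sup>2 * annular 0 x * (5/3 * u\<^sup>2 - 500/729 * u^4)"
      unfolding F by (simp add: algebra_simps)
    also have "\<dots> \<le> F1 x"
      unfolding F by (intro mult_left_mono ineq) (simp add: annular_nonneg)
    finally show ?thesis using True by simp
  next
    case False
    then show ?thesis
      by (auto simp: F0_def F1_def F2_def F4_def annular_le_1 not_less)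
  qed
  then have "K (\<lambda>x. (5/6 - 125/486) * F0 x + (5/6 - 250/729) * F2 x - 125/1458 * F4 x) \<le> K F1"
    unfolding K_def by (intro integral_mono intK i1) (simp_all add: i0 i2 i4)
  moreover have "K (\<lambda>x. (5/6 - 125/486) * F0 x + (5/6 - 250/729) * F2 x - 125/1458 * F4 x)
      = (5/6 - 125/486) * K F0 + (5/6 - 250/729) * K F2 - 125/1458 * K F4"
  proof -
    have "K (\<lambda>x. (5/6 - 125/486) * F0 x + (5/6 - 250/729) * F2 x - 125/1458 * F4 x)
      = (\<integral>x. (5/6 - 125/486) * (indicator {x. x \<bullet> e > 0} x * F0 x)
          + (5/6 - 250/729) * (indicator {x. x \<bullet> e > 0} x * F2 x)
          - 125/1458 * (indicator {x. x \<bullet> e > 0} x * F4 x) \<partial>lebesgue)"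
      unfolding K_def by (intro Bochner_Integration.integral_cong) (auto simp: algebra_simps)
    then show ?thesis
      using intK[OF i0] intK[OF i2] intK[OF i4] by (simp add: K_def)
  qed
  \<comment> \<open>\<open>F2\<close> and \<open>F4\<close> drop out, leaving the constant 5/6 -
    125/486 = 140/243 > 0.576.\<close>
  ultimately have K1: "K F1 \<ge> 0.576 * K F0"
    using K0 by (simp add: K2 K4)
  show "K (\<lambda>x. (norm x)\<^sup>2 * annular 0 x) > 0"
    using K0 by (simp add: F0_def)
  show "K (\<lambda>x. (norm x)\<^sup>2 * ((2 * (x \<bullet> e)\<^sup>2 - (norm x)\<^sup>2) * annular 2 x)) = 0"
    using K2 by (simp add: F2_def mult.assoc)
  show "K (\<lambda>x. (norm x)\<^sup>2 * ((x \<bullet> e) * annular 1 x)) \<ge> 0.576 * K (\<lambda>x. (norm x)\<^sup>2 * annular 0 x)"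
    using K1 by (simp add: F0_def F1_def mult.assoc)
qed

section \<open>Contradiction from the first three angular moments\<close>

lemma homogeneous_solution_epsilon_zero:
  assumes small: "\<bar>\<epsilon>\<bar> < 1/10" and nonneg: "\<And>x. v x \<ge> 0"
    and sol: "strong_solution (coeff_matrix \<epsilon>) v" and hom: "homogeneous_deg2 v"
    and bd: "boundary_differentiable_at_origin {x. v x > 0}"
  shows "\<epsilon> = 0"
proof (rule ccontr)
  assume "\<epsilon> \<noteq> 0"
  obtain e where e: "norm e = 1" and U: "AE x in lebesgue. v x > 0 \<longleftrightarrow> x \<bullet> e > 0"
    using AE_positive_half_plane[OF hom bd] by blast
  define J where "J = (\<lambda>G. \<integral>x. v x * G x \<partial>lebesgue)"
  define K where "K = (\<lambda>p :: real^2 \<Rightarrow> real. \<integral>x. indicator {x. x \<bullet> e > 0} x * p x \<partial>lebesgue)"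
  have v: "L2_loc v" using sol by (auto simp: strong_solution_def W22_loc_with_def)
  \<comment> \<open>For an angular eigenfunction p with eigenvalue k, the weak equation becomes a
    scalar relation between the moment \<open>J\<close> of v and the half plane moment
    \<open>K\<close>.\<close>
  have key: "((1 + \<epsilon>) * k + (4 + 2 * \<epsilon>)) * J (\<lambda>x. p x * annular n x) = K (\<lambda>x. (norm x)\<^sup>2 * (p x * annular n x))"
    if p: "smooth p" "rot_deriv (rot_deriv p) = (\<lambda>x. k * p x)" for p k n
  proof -
    have G: "test_function (\<lambda>x. p x * annular n x)"
      by (intro test_function_mult p test_function_annular)
    have "((1 + \<epsilon>) * k + (4 + 2 * \<epsilon>)) * J (\<lambda>x. p x * annular n x) =
        (\<integral>x. v x * ((1 + \<epsilon>) * rot_deriv (rot_deriv (\<lambda>x. p x * annular n x)) x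
          + (4 + 2 * \<epsilon>) * (p x * annular n x)) \<partial>lebesgue)"
      unfolding J_def rot_deriv_annular_mult[OF p(1)] p(2)
      by (subst Bochner_Integration.integral_mult_right_zero[symmetric])
        (intro Bochner_Integration.integral_cong, auto simp: algebra_simps)
    also have "\<dots> = (\<integral>x. indicator {y. v y > 0} x * ((norm x)\<^sup>2 * (p x * annular n x)) \<partial>lebesgue)"
      by (rule weak_angular_equation[OF sol hom G])
    also have "\<dots> = K (\<lambda>x. (norm x)\<^sup>2 * (p x * annular n x))"
      unfolding K_def
    proof (rule integral_cong_AE)
      have [measurable]: "v \<in> borel_measurable lebesgue" using v by (simp add: L2_loc_def)
      have [measurable]: "(\<lambda>x. p x * annular n x) \<in> borel_measurable lebesgue"
        using G by (intro smooth_measurable test_function_smooth)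
      have [measurable]: "(norm :: real^2 \<Rightarrow> real) \<in> borel_measurable lebesgue"
        by (rule measurable_completion) simp
      show "(\<lambda>x. indicator {y. v y > 0} x * ((norm x)\<^sup>2 * (p x * annular n x))) \<in> borel_measurable lebesgue"
        "(\<lambda>x. indicator {x. x \<bullet> e > 0} x * ((norm x)\<^sup>2 * (p x * annular n x))) \<in> borel_measurable lebesgue"
        by measurable
      show "AE x in lebesgue. indicator {y. v y > 0} x * ((norm x)\<^sup>2 * (p x * annular n x))
          = indicator {x. x \<bullet> e > 0} x * ((norm x)\<^sup>2 * (p x * annular n x))"
        using U by eventually_elim (simp add: indicator_def)
    qed
    finally show ?thesis .
  qed
  define G0 where "G0 = (\<lambda>x::real^2. annular 0 x)"
  define G1 where "G1 = (\<lambda>x. (x \<bullet> e) * annular 1 x)"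
  define G2 where "G2 = (\<lambda>x. (2 * (x \<bullet> e)\<^sup>2 - (norm x)\<^sup>2) * annular 2 x)"
  \<comment> \<open>The eigenvalues 0, -1, -4 turn (1 + \<epsilon>) k + 4 + 2\<epsilon> into 4 +
    2\<epsilon>, 3 + \<epsilon> and -2\<epsilon>.\<close>
  have e0: "(4 + 2 * \<epsilon>) * J G0 = K (\<lambda>x. (norm x)\<^sup>2 * G0 x)"
    using key[of "\<lambda>x. 1" 0 0]
    by (simp add: G0_def smooth_const rot_deriv_def[abs_def] partial_deriv_fun_simps)
  have e1: "(3 + \<epsilon>) * J G1 = K (\<lambda>x. (norm x)\<^sup>2 * G1 x)"
    using key[OF _ rot_deriv_linear[of e], of 1]
    by (simp add: G1_def inner_2 smooth_intros algebra_simps)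
  have e2: "(- 2 * \<epsilon>) * J G2 = K (\<lambda>x. (norm x)\<^sup>2 * G2 x)"
    using key[OF _ rot_deriv_quadratic[OF e], of 2]
    by (simp add: G2_def inner_2 norm_square_2 smooth_intros)
  have mom: "K (\<lambda>x. (norm x)\<^sup>2 * G0 x) > 0" "K (\<lambda>x. (norm x)\<^sup>2 * G2 x) = 0"
    "K (\<lambda>x. (norm x)\<^sup>2 * G1 x) \<ge> 0.576 * K (\<lambda>x. (norm x)\<^sup>2 * G0 x)"
    unfolding K_def G0_def G1_def G2_def by (rule annular_moments[OF e])+
  \<comment> \<open>At \<epsilon> = 0 the second harmonic is in the kernel of the angular operator
    and its moment is free; otherwise it is forced to vanish.\<close>
  have J2: "J G2 = 0"
    using e2 mom(2) \<open>\<epsilon> \<noteq> 0\<close> by simp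
  have tests: "test_function G0" "test_function G1" "test_function G2"
    unfolding G0_def G1_def G2_def inner_2 norm_square_2
    by (intro test_function_mult test_function_annular smooth_intros)+
  \<comment> \<open>cos 2\<theta> / 2 - cos \<theta> + 3/4 = (cos \<theta> - 1/2)^2, so v is tested
    against a nonnegative function built from the three harmonics.\<close>
  have "0 \<le> (\<integral>x. v x * (G2 x / 2 - G1 x + 3/4 * G0 x) \<partial>lebesgue)"
  proof (intro integral_nonneg_AE AE_I2 mult_nonneg_nonneg nonneg)
    fix x
    show "G2 x / 2 - G1 x + 3/4 * G0 x \<ge> 0"
    proof (cases "norm x > 1")
      case True
      define s where "s = norm x"
      define u where "u = (x \<bullet> e) / s"
      have s: "s > 0" using True unfolding s_def by linarith
      have y: "x \<bullet> e = s * u" using s by (simp add: u_def)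
      have "G1 x = annular 0 x * u" "G2 x = annular 0 x * (2 * u\<^sup>2 - 1)"
        unfolding G1_def G2_def y s_def[symmetric]
          annular_eq[of 1 x, unfolded s_def[symmetric]] annular_eq[of 2 x, unfolded s_def[symmetric]]
        using s by (simp_all add: field_simps power2_eq_square)
      then have "G2 x / 2 - G1 x + 3/4 * G0 x = annular 0 x * (u - 1/2)\<^sup>2"
        unfolding G0_def by (simp add: power2_eq_square algebra_simps)
      then show ?thesis by (simp add: annular_nonneg)
    qed (simp add: G0_def G1_def G2_def annular_le_1)
  qed
  also have "\<dots> = (\<integral>x. (v x * G2 x) / 2 - v x * G1 x + 3/4 * (v x * G0 x) \<partial>lebesgue)"
    by (intro Bochner_Integration.integral_cong) (auto simp: algebra_simps)
  also have "\<dots> = J G2 / 2 - J G1 + 3/4 * J G0"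
    using integrable_L2_loc_test[OF v tests(1)] integrable_L2_loc_test[OF v tests(2)]
      integrable_L2_loc_test[OF v tests(3)] by (simp add: J_def)
  finally have J: "J G1 \<le> 3/4 * J G0" by (simp add: J2)
  have pos: "(4 + 2 * \<epsilon>) * J G0 > 0"
    using e0 mom(1) by simp
  then have J0: "J G0 > 0" using small by (auto simp: zero_less_mult_iff abs_if split: if_splits)
  have "0.576 * ((4 + 2 * \<epsilon>) * J G0) \<le> (3 + \<epsilon>) * J G1"
    using mom(3) e0 e1 by simp
  also have "\<dots> \<le> (3 + \<epsilon>) * (3/4 * J G0)"
    using small J by (intro mult_left_mono) auto
  finally have "(0.576 * (4 + 2 * \<epsilon>)) * J G0 \<le> ((3 + \<epsilon>) * (3/4)) * J G0"
    by (simp only: mult.assoc)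
  then have "0.576 * (4 + 2 * \<epsilon>) \<le> (3 + \<epsilon>) * (3/4)"
    using J0 by (simp only: mult_le_cancel_right_pos)
  \<comment> \<open>The inequality amounts to 0.402 \<epsilon> \<le> -0.054, so \<epsilon> < -0.13,
    which the bound 1/10 excludes.\<close>
  then show False using small by (simp add: abs_less_iff)
qed

theorem theorem5p1:
  "\<exists>\<epsilon>\<^sub>0>0::real. \<forall>\<epsilon>::real. \<bar>\<epsilon>\<bar> < \<epsilon>\<^sub>0 \<longrightarrow>
     (\<forall>v :: real^2 \<Rightarrow> real.
        (\<forall>x. v x \<ge> 0) \<longrightarrow>
        strong_solution (coeff_matrix \<epsilon>) v \<longrightarrow>
        homogeneous_deg2 v \<longrightarrow>
        0 \<in> frontier {x. v x > 0} \<longrightarrow>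
        boundary_differentiable_at_origin {x. v x > 0} \<longrightarrow>
        \<epsilon> = 0 \<and> (\<forall>x. x \<noteq> 0 \<longrightarrow> coeff_matrix \<epsilon> x = mat 1))"
proof (rule exI[of _ "1/10"], intro conjI allI impI)
  fix \<epsilon> :: real and v :: "real^2 \<Rightarrow> real" and x :: "real^2"
  assume "\<bar>\<epsilon>\<bar> < 1/10" "\<forall>x. v x \<ge> 0" "strong_solution (coeff_matrix \<epsilon>) v"
    "homogeneous_deg2 v" "boundary_differentiable_at_origin {x. v x > 0}"
  then show eps: "\<epsilon> = 0" using homogeneous_solution_epsilon_zero by blast
  show "coeff_matrix \<epsilon> x = mat 1"
    by (simp add: eps coeff_matrix_def vec_eq_iff forall_2 mat_def)
qed simp

end
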